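(* Let $(a,b)\subseteq\mathbb{R}$ be a finite or infinite interval, $x_0\in(a,b)$, $z\in\mathbb{C}$, $Y_0,Y_1\in\mathcal{B}(\mathcal{H})$, and suppose $F,V:(a,b)\to\mathcal{B}(\mathcal{H})$ are two weakly measurable operator-valued functions with $\|V(\cdot)\|_{\mathcal{B}(\mathcal{H})},\|F(\cdot)\|_{\mathcal{B}(\mathcal{H})}\in L^1_{\mathrm{loc}}((a,b);dx)$. Then there is a unique $\mathcal{B}(\mathcal{H})$-valued solution $Y(z,\cdot,x_0):(a,b)\to\mathcal{B}(\mathcal{H})$ of the initial value problem $$-Y''+(V-z)Y=F\ \text{ on } (a,b)\setminus E,\qquad Y(x_0)=Y_0,\quad Y'(x_0)=Y_1,$$ where the exceptional set $E$ is of Lebesgue measure zero and independent of $z$. Moreover, the following properties hold: (i) For fixed $x_0\in(a,b)$ and $z\in\mathbb{C}$, $Y(z,x,x_0)$ is continuously differentiable with respect to $x$ on $(a,b)$ in the $\mathcal{B}(\mathcal{H})$-norm. (ii) For fixed $x_0\in(a,b)$ and $z\in\mathbb{C}$, $Y'(z,x,x_0)$ is strongly differentiable with respect to $x$ on $(a,b)\setminus E$. (iii) For fixed $x_0,x\in(a,b)$, $Y(z,x,x_0)$ and $Y'(z,x,x_0)$ are entire in $z$ in the $\mathcal{B}(\mathcal{H})$-norm.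
   Context: $\mathcal{H}$ is a complex separable Hilbert space; $\mathcal{B}(\mathcal{H})$ is the Banach space of bounded linear operators on $\mathcal{H}$. An operator-valued function $V$ is weakly measurable if $x\mapsto(f,V(x)g)_{\mathcal{H}}$ is Lebesgue measurable for all $f,g\in\mathcal{H}$. Integrals of $\mathcal{H}$-valued functions are Bochner integrals. $W^{2,1}_{\mathrm{loc}}((a,b);dx;\mathcal{H})$ is the set of $y:(a,b)\to\mathcal{H}$ such that $y(x)=y(x_1)+\int_{x_1}^x y'(t)\,dt$ and $y'(x)=y'(x_1)+\int_{x_1}^x y''(t)\,dt$ with $y',y''\in L^1_{\mathrm{loc}}((a,b);dx;\mathcal{H})$. Definition of solution: for weakly measurable $Q,F:(a,b)\to\mathcal{B}(\mathcal{H})$ with $\|Q(\cdot)\|,\|F(\cdot)\|\in L^1_{\mathrm{loc}}((a,b);dx)$, a function $Y:(a,b)\to\mathcal{B}(\mathcal{H})$ is called a solution of $-Y''+QY=F$ if $Y(\cdot)h\in W^{2,1}_{\mathrm{loc}}((a,b);dx;\mathcal{H})$ for every $h\in\mathcal{H}$ and $-Y''h+QYh=Fh$ holds a.e. on $(a,b)$. Unless stated otherwise, derivatives, continuity, and differentiability of operator-valued functions are in the strong sense, i.e., pointwise: they refer to $x\mapsto Y(x)h$ in $\mathcal{H}$ for each $h\in\mathcal{H}$. *)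

theory Defs
  imports "HOL-Analysis.Analysis"
begin

text \<open>
  The distribution has no complex Hilbert spaces. The class below adds a complex scalar
  multiplication and a complex inner product to a Banach space; the inner product is linear
  in its second argument. Its last axiom makes the inner product positive
  definite and says that it induces the norm (hence also the topology) of the type.
\<close>

class complex_hilbert = banach +
  fixes scaleC :: "complex \<Rightarrow> 'a \<Rightarrow> 'a"  (infixr \<open>*\<^sub>C\<close> 75)
    and cinner :: "'a \<Rightarrow> 'a \<Rightarrow> complex"
  assumes scaleC_of_real: "complex_of_real r *\<^sub>C x = r *\<^sub>R x"
    and scaleC_add_right: "c *\<^sub>C (x + y) = c *\<^sub>C x + c *\<^sub>C y"
    and scaleC_add_left: "(c + d) *\<^sub>C x = c *\<^sub>C x + d *\<^sub>C x"
    and scaleC_scaleC: "c *\<^sub>C d *\<^sub>C x = (c * d) *\<^sub>C x"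
    and cinner_commute: "cinner x y = cnj (cinner y x)"
    and cinner_add_right: "cinner x (y + y') = cinner x y + cinner x y'"
    and cinner_scaleC_right: "cinner x (c *\<^sub>C y) = c * cinner x y"
    and cinner_self: "cinner x x = complex_of_real ((norm x)\<^sup>2)"

class separable_complex_hilbert = complex_hilbert +
  assumes separable: "\<exists>D. countable D \<and> (\<forall>x. \<forall>e>0. \<exists>d\<in>D. dist d x < e)"

text \<open>
  The library's Bochner integral is available on second countable spaces; a metric space
  is second countable iff it is separable.
\<close>

instance separable_complex_hilbert \<subseteq> second_countable_topology
proof
  obtain D :: "'a set" where D: "countable D" "\<And>x e. e > 0 \<Longrightarrow> \<exists>d\<in>D. dist d x < e"
    using separable by blast
  define B where "B = (\<lambda>(d, n). ball d (1 / real (Suc n))) ` (D \<times> (UNIV :: nat set))"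
  have "topological_basis B"
  proof (rule topological_basisI)
    fix S assume "S \<in> B"
    then show "open S" by (auto simp: B_def)
  next
    fix S :: "'a set" and x assume "open S" "x \<in> S"
    then obtain e where e: "e > 0" "ball x e \<subseteq> S"
      using open_contains_ball by blast
    then obtain n where n: "1 / real (Suc n) < e / 2"
      using nat_approx_posE[of "e / 2"] by (metis half_gt_zero)
    obtain d where d: "d \<in> D" "dist d x < 1 / real (Suc n)"
      using D(2)[of "1 / real (Suc n)" x] by auto
    have "ball d (1 / real (Suc n)) \<subseteq> ball x e"
    proof
      fix y assume "y \<in> ball d (1 / real (Suc n))"
      then have "dist x y < e"
        using d(2) n dist_triangle[of x y d] by (simp add: dist_commute)
      then show "y \<in> ball x e" by simp
    qed
    moreover have "ball d (1 / real (Suc n)) \<in> B"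
      using d(1) by (force simp: B_def)
    ultimately show "\<exists>B'\<in>B. x \<in> B' \<and> B' \<subseteq> S"
      using d(2) e(2) by (metis mem_ball order_trans)
  qed
  moreover have "countable B" using D(1) by (simp add: B_def)
  ultimately show "\<exists>B :: 'a set set. countable B \<and> open = generate_topology B"
    using topological_basis_imp_subbasis by blast
qed

lemma norm_scaleC: "norm (c *\<^sub>C x) = cmod c * norm (x :: 'a :: complex_hilbert)"
proof -
  have "complex_of_real ((norm (c *\<^sub>C x))\<^sup>2) = c * cnj (c * cinner x x)"
    by (metis cinner_commute cinner_scaleC_right cinner_self)
  also have "\<dots> = complex_of_real ((cmod c * norm x)\<^sup>2)"
    by (simp add: cinner_self power_mult_distrib mult.assoc[symmetric] flip: complex_norm_square)
  finally have "(norm (c *\<^sub>C x))\<^sup>2 = (cmod c * norm x)\<^sup>2"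
    by (simp only: of_real_eq_iff)
  then show ?thesis by simp
qed

text \<open>The type \<open>'a \<Rightarrow>\<^sub>L 'a\<close> consists of the bounded real-linear operators, with the operator
  norm. The space \<open>\<B>(\<H>)\<close> is its closed subspace of complex-linear operators.\<close>

definition BH :: "('a::complex_hilbert \<Rightarrow>\<^sub>L 'a) set" where
  "BH = {T. \<forall>c x. blinfun_apply T (c *\<^sub>C x) = c *\<^sub>C blinfun_apply T x}"

lift_definition cscale :: "complex \<Rightarrow> 'a::complex_hilbert \<Rightarrow>\<^sub>L 'a" is "\<lambda>c x. c *\<^sub>C x"
proof (rule bounded_linear_intro)
  fix c :: complex and x y :: 'a and r :: real
  show "c *\<^sub>C (x + y) = c *\<^sub>C x + c *\<^sub>C y" by (rule scaleC_add_right)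
  show "c *\<^sub>C (r *\<^sub>R x) = r *\<^sub>R (c *\<^sub>C x)"
    by (metis mult.commute scaleC_of_real scaleC_scaleC)
  show "norm (c *\<^sub>C x) \<le> norm x * cmod c"
    by (simp add: norm_scaleC mult.commute)
qed

definition weakly_measurable_on :: "real set \<Rightarrow> (real \<Rightarrow> 'a::complex_hilbert \<Rightarrow>\<^sub>L 'a) \<Rightarrow> bool" where
  "weakly_measurable_on I V \<longleftrightarrow>
    (\<forall>f g. (\<lambda>x. cinner f (blinfun_apply (V x) g)) \<in> borel_measurable (lebesgue_on I))"

definition L1loc :: "real set \<Rightarrow> (real \<Rightarrow> 'b::{banach, second_countable_topology}) set" where
  "L1loc I = {f. \<forall>c d. {c..d} \<subseteq> I \<longrightarrow> set_integrable lebesgue {c..d} f}"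

text \<open>\<open>W21loc_derivs I y y' y''\<close>: the function \<open>y\<close> lies in \<open>W\<^sup>2\<^sup>,\<^sup>1\<close> locally on the open interval \<open>I\<close>,
  with derivatives \<open>y'\<close> (determined everywhere on \<open>I\<close>) and \<open>y''\<close> (determined almost everywhere).
  The integrals are oriented: their sign changes if \<open>x < x\<^sub>1\<close>.\<close>

definition W21loc_derivs ::
  "real set \<Rightarrow> (real \<Rightarrow> 'b) \<Rightarrow> (real \<Rightarrow> 'b) \<Rightarrow> (real \<Rightarrow> 'b::{banach, second_countable_topology}) \<Rightarrow> bool"
where
  "W21loc_derivs I y y' y'' \<longleftrightarrow>
    y' \<in> L1loc I \<and> y'' \<in> L1loc I \<and>
    (\<forall>x\<^sub>1\<in>I. \<forall>x\<in>I.
      y x = y x\<^sub>1 + interval_lebesgue_integral lebesgue (ereal x\<^sub>1) (ereal x) y' \<and>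
      y' x = y' x\<^sub>1 + interval_lebesgue_integral lebesgue (ereal x\<^sub>1) (ereal x) y'')"

text \<open>The exceptional null set of the equation \<open>-Y''h + QYh = Fh\<close> may depend on \<open>h\<close> here.\<close>

definition is_solution ::
  "real set \<Rightarrow> (real \<Rightarrow> 'a \<Rightarrow>\<^sub>L 'a) \<Rightarrow> (real \<Rightarrow> 'a \<Rightarrow>\<^sub>L 'a) \<Rightarrow>
    (real \<Rightarrow> 'a::separable_complex_hilbert \<Rightarrow>\<^sub>L 'a) \<Rightarrow> bool"
where
  "is_solution I Q F Y \<longleftrightarrow>
    (\<forall>x\<in>I. Y x \<in> BH) \<and>
    (\<forall>h. \<exists>y' y''. W21loc_derivs I (\<lambda>x. blinfun_apply (Y x) h) y' y'' \<and>
      (AE x in lebesgue. x \<in> I \<longrightarrow>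
        - y'' x + blinfun_apply (Q x) (blinfun_apply (Y x) h) = blinfun_apply (F x) h))"

definition has_strong_derivative ::
  "(real \<Rightarrow> 'a::complex_hilbert \<Rightarrow>\<^sub>L 'a) \<Rightarrow> ('a \<Rightarrow>\<^sub>L 'a) \<Rightarrow> real \<Rightarrow> bool" where
  "has_strong_derivative Y D x \<longleftrightarrow>
    (\<forall>h. ((\<lambda>t. blinfun_apply (Y t) h) has_vector_derivative blinfun_apply D h) (at x))"

definition is_ivp_solution ::
  "real set \<Rightarrow> (real \<Rightarrow> 'a \<Rightarrow>\<^sub>L 'a) \<Rightarrow> (real \<Rightarrow> 'a \<Rightarrow>\<^sub>L 'a) \<Rightarrow> real \<Rightarrow> ('a \<Rightarrow>\<^sub>L 'a) \<Rightarrow> ('a \<Rightarrow>\<^sub>L 'a) \<Rightarrow>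
    (real \<Rightarrow> 'a::separable_complex_hilbert \<Rightarrow>\<^sub>L 'a) \<Rightarrow> bool"
where
  "is_ivp_solution I Q F x\<^sub>0 Y\<^sub>0 Y\<^sub>1 Y \<longleftrightarrow>
    is_solution I Q F Y \<and> Y x\<^sub>0 = Y\<^sub>0 \<and> has_strong_derivative Y Y\<^sub>1 x\<^sub>0"

text \<open>Complex differentiability on all of \<open>\<complex>\<close>, as a limit of difference quotients in operator norm.\<close>

definition entire_BH :: "(complex \<Rightarrow> 'a::complex_hilbert \<Rightarrow>\<^sub>L 'a) \<Rightarrow> bool" where
  "entire_BH f \<longleftrightarrow>
    (\<forall>z. \<exists>D\<in>BH. ((\<lambda>w. cscale (1 / (w - z)) o\<^sub>L (f w - f z)) \<longlongrightarrow> D) (at z))"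

end

theory Submission
  imports Defs
begin

text \<open>Write the second-order problem as the first-order integral equation
  \<open>u(x) = v(x) + \<integral>\<^sub>x\<^sub>0\<^sup>x A(t) u(t) dt\<close> for the phase-space vector \<open>u = (Y h, Y' h)\<close> in
  \<open>\<H> \<times> \<H>\<close>, where \<open>A(t) (p, q) = (q, V(t) p - z p)\<close> and \<open>v\<close> carries \<open>Y\<^sub>0 h\<close>, \<open>Y\<^sub>1 h\<close> and the integral
  of \<open>F h\<close>. An operator-valued \<open>V\<close> need not be Bochner integrable, because the operators in general do not form a
  separable space. For a fixed vector \<open>h\<close>, however, \<open>V(\<cdot>) h\<close> is measurable by Pettis' theorem
  (\<open>Pettis_measurable\<close>), so the equation makes sense vector by vector. The norms of the operators
  enter only through a locally integrable rate \<open>k\<close> with \<open>\<parallel>A(t)\<parallel> \<le> k(t)\<close>.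

  With \<open>K(x) = \<integral>\<^sub>x\<^sub>0\<^sup>x k\<close>, the weight \<open>exp (2 \<bar>K\<bar>)\<close> makes the integral operator a contraction with
  factor \<open>1/2\<close> (\<open>oint_exp_weight_le\<close>). This gives existence by Picard iteration (\<open>solves_exists\<close>) and
  a Gronwall estimate (\<open>solves_norm_le\<close>). The estimate implies uniqueness; uniqueness makes the
  solution linear in \<open>h\<close>, and the estimate makes it bounded in \<open>h\<close>, so that the solutions for all \<open>h\<close>
  assemble to operators \<open>Y(x)\<close> and \<open>Y'(x)\<close> (\<open>ivp_pair_exists\<close>). Since the increments of \<open>Y' h\<close> are
  bounded by \<open>\<parallel>h\<parallel>\<close> times the integral of a locally integrable function that does not involve \<open>h\<close>,
  \<open>Y'\<close> is continuous in operator norm, and \<open>Y\<close> is continuously differentiable in operator norm.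

  The equation \<open>Y'' h = (V - z) Y h - F h\<close> holds wherever the indefinite integrals of \<open>V Y h\<close> and \<open>F h\<close>
  can be differentiated. Lebesgue's differentiation theorem gives such points for \<open>\<parallel>V\<parallel>\<close>, \<open>\<parallel>F\<parallel>\<close> and for
  \<open>V d\<close>, \<open>F d\<close> with \<open>d\<close> in a countable dense set of vectors. One null set therefore serves for
  all these functions, and by approximation it serves for every continuous function in place of \<open>d\<close>
  (\<open>oint_A_has_vector_derivative_ae\<close>), hence for every \<open>h\<close> and every \<open>z\<close>.

  Differentiating the equation formally in \<open>z\<close> shows that \<open>D = dY/dz\<close> should solve
  \<open>-D'' + (V - z) D = Y\<close> with zero initial values. That problem has a solution \<open>D\<close>, and the difference between
  a difference quotient of \<open>Y\<close> and \<open>D\<close> solves an equation of the same kind whose data are of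
  size \<open>O(\<bar>w - z\<bar>)\<close>; the Gronwall estimate does the rest (\<open>ivp_pair_difference_quotient\<close>).\<close>

section \<open>Oriented integrals of locally integrable functions\<close>

text \<open>The oriented integral of \<open>W21loc_derivs\<close> with real endpoints. As an abbreviation it makes the facts below
  apply to that definition directly.\<close>

abbreviation oint :: "(real \<Rightarrow> 'b::{banach, second_countable_topology}) \<Rightarrow> real \<Rightarrow> real \<Rightarrow> 'b" where
  "oint f p q \<equiv> interval_lebesgue_integral lebesgue (ereal p) (ereal q) f"

lemma oint_eq_set_integral:
  assumes "p \<le> q"
  shows "oint f p q = (LINT t:{p..q}|lebesgue. f t)"
proof -
  have "oint f p q = (LINT t:{p<..<q}|lebesgue. f t)"
    using assms by (simp add: interval_lebesgue_integral_def)
  also have "\<dots> = (LINT t:{p..q}|lebesgue. f t)"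
    by (rule set_integral_discrete_difference[where X="{p,q}"]) auto
  finally show ?thesis .
qed

lemma oint_swap: "oint f q p = - oint f p q"
  by (cases p q rule: linorder_cases)
     (auto simp: interval_lebesgue_integral_def set_lebesgue_integral_def)

lemma oint_same [simp]: "oint f p p = 0"
  by (simp add: interval_lebesgue_integral_def set_lebesgue_integral_def)

lemma oint_const: "oint (\<lambda>_. c) p q = (q - p) *\<^sub>R c"
proof -
  have *: "oint (\<lambda>_. c) p q = (q - p) *\<^sub>R c" if "p \<le> q" for p q
    using that by (simp add: oint_eq_set_integral set_lebesgue_integral_def)
  show ?thesis
    using *[of p q] *[of q p]
    by (cases "p \<le> q") (auto simp: oint_swap[of p q] simp flip: scaleR_minus_left)
qed

lemma oint_cong:
  assumes "\<And>t. min p q \<le> t \<Longrightarrow> t \<le> max p q \<Longrightarrow> f t = g t"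
  shows "oint f p q = oint g p q"
proof -
  have *: "oint f p q = oint g p q" if "p \<le> q" "\<And>t. t \<in> {p..q} \<Longrightarrow> f t = g t" for p q
    using that by (auto simp: oint_eq_set_integral intro!: set_lebesgue_integral_cong)
  show ?thesis
    using *[of p q] *[of q p] assms by (cases "p \<le> q") (auto simp: oint_swap[of p q])
qed

lemma L1loc_integrable: "f \<in> L1loc I \<Longrightarrow> {c..d} \<subseteq> I \<Longrightarrow> set_integrable lebesgue {c..d} f"
  by (auto simp: L1loc_def)

lemma L1loc_add: "f \<in> L1loc I \<Longrightarrow> g \<in> L1loc I \<Longrightarrow> (\<lambda>t. f t + g t) \<in> L1loc I"
  by (auto simp: L1loc_def)

lemma L1loc_diff: "f \<in> L1loc I \<Longrightarrow> g \<in> L1loc I \<Longrightarrow> (\<lambda>t. f t - g t) \<in> L1loc I"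
  by (auto simp: L1loc_def)

lemma L1loc_norm: "f \<in> L1loc I \<Longrightarrow> (\<lambda>t. norm (f t)) \<in> L1loc I"
  by (simp add: L1loc_def set_integrable_norm)

lemma set_integrable_bounded_linear:
  fixes T :: "'b::{banach, second_countable_topology} \<Rightarrow> 'c::{banach, second_countable_topology}"
  assumes "bounded_linear T" "set_integrable M S f"
  shows "set_integrable M S (\<lambda>t. T (f t))"
    and "(LINT t:S|M. T (f t)) = T (LINT t:S|M. f t)"
proof -
  interpret bounded_linear T by fact
  have eq: "(\<lambda>x. indicator S x *\<^sub>R T (f x)) = (\<lambda>x. T (indicator S x *\<^sub>R f x))"
    by (simp add: scaleR)
  show "set_integrable M S (\<lambda>t. T (f t))"
    using integrable_bounded_linear[OF assms(1) assms(2)[unfolded set_integrable_def]]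
    by (simp add: set_integrable_def eq)
  show "(LINT t:S|M. T (f t)) = T (LINT t:S|M. f t)"
    using integral_bounded_linear[OF assms(1) assms(2)[unfolded set_integrable_def]]
    by (simp add: set_lebesgue_integral_def eq)
qed

lemma L1loc_bounded_linear:
  fixes T :: "'b::{banach, second_countable_topology} \<Rightarrow> 'c::{banach, second_countable_topology}"
  shows "bounded_linear T \<Longrightarrow> f \<in> L1loc I \<Longrightarrow> (\<lambda>t. T (f t)) \<in> L1loc I"
  by (auto simp: L1loc_def intro: set_integrable_bounded_linear)

lemma L1loc_scaleR: "f \<in> L1loc I \<Longrightarrow> (\<lambda>t. r *\<^sub>R f t) \<in> L1loc I"
  by (auto simp: L1loc_def)

lemma L1loc_continuous:
  fixes f :: "real \<Rightarrow> 'b::{banach, second_countable_topology}"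
  assumes "continuous_on I f"
  shows "f \<in> L1loc I"
  unfolding L1loc_def
proof (intro CollectI allI impI)
  fix c d :: real assume "{c..d} \<subseteq> I"
  then have "set_integrable lborel {c..d} f"
    unfolding set_integrable_def
    using borel_integrable_compact[of "{c..d}" f] continuous_on_subset[OF assms] by auto
  then show "set_integrable lebesgue {c..d} f"
    unfolding set_integrable_def
    by (subst integrable_completion) (rule borel_measurable_integrable)
qed

lemma L1loc_mult_continuous:
  fixes k u :: "real \<Rightarrow> real"
  assumes k: "k \<in> L1loc I" and u: "continuous_on I u"
  shows "(\<lambda>t. k t * u t) \<in> L1loc I"
  unfolding L1loc_def
proof (intro CollectI allI impI)
  fix c d :: real assume cd: "{c..d} \<subseteq> I"
  have "compact (u ` {c..d})"
    using continuous_on_subset[OF u cd] by (intro compact_continuous_image) auto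
  then obtain B where B: "\<And>t. t \<in> {c..d} \<Longrightarrow> \<bar>u t\<bar> \<le> B"
    using compact_imp_bounded[THEN bounded_iff[THEN iffD1]] by fastforce
  note ik = L1loc_integrable[OF k cd] and iu = L1loc_integrable[OF L1loc_continuous[OF u] cd]
  show "set_integrable lebesgue {c..d} (\<lambda>t. k t * u t)"
  proof (rule set_integrable_bound)
    show "set_integrable lebesgue {c..d} (\<lambda>t. B * k t)"
      using ik by simp
    have "(\<lambda>t. (indicator {c..d} t *\<^sub>R k t) * (indicator {c..d} t *\<^sub>R u t)) \<in> borel_measurable lebesgue"
      using ik iu by (intro borel_measurable_times) (auto simp: set_integrable_def)
    moreover have "(\<lambda>t. (indicator {c..d} t *\<^sub>R k t) * (indicator {c..d} t *\<^sub>R u t)) =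
        (\<lambda>t. indicator {c..d} t *\<^sub>R (k t * u t))"
      by (auto simp: indicator_def)
    ultimately show "set_borel_measurable lebesgue {c..d} (\<lambda>t. k t * u t)"
      by (simp add: set_borel_measurable_def)
    show "AE t in lebesgue. t \<in> {c..d} \<longrightarrow> norm (k t * u t) \<le> norm (B * k t)"
    proof (intro AE_I2 impI)
      fix t assume "t \<in> {c..d}"
      then have "\<bar>u t\<bar> \<le> \<bar>B\<bar>" using B[of t] by linarith
      then show "norm (k t * u t) \<le> norm (B * k t)"
        unfolding real_norm_def abs_mult mult.commute[of "\<bar>k t\<bar>"] by (rule mult_right_mono) simp
    qed
  qed
qed

text \<open>The dominating constant may depend on the compact subinterval. This is the form needed for
  \<open>A t (u t)\<close> with \<open>u\<close> continuous, because \<open>u\<close> need not be bounded on all of \<open>I\<close>.\<close>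

lemma L1loc_dominated:
  fixes f :: "real \<Rightarrow> 'b::{banach, second_countable_topology}" and k :: "real \<Rightarrow> real"
  assumes "k \<in> L1loc I" "f \<in> borel_measurable (lebesgue_on I)" "I \<in> sets lebesgue"
    and "\<And>c d. {c..d} \<subseteq> I \<Longrightarrow> \<exists>B. \<forall>t\<in>{c..d}. norm (f t) \<le> B * k t"
  shows "f \<in> L1loc I"
  unfolding L1loc_def
proof (intro CollectI allI impI)
  fix c d :: real assume cd: "{c..d} \<subseteq> I"
  then obtain B where B: "\<And>t. t \<in> {c..d} \<Longrightarrow> norm (f t) \<le> B * k t"
    using assms(4) by meson
  have "set_integrable lebesgue {c..d} (\<lambda>t. B * k t)"
    using L1loc_integrable[OF assms(1) cd] by simp
  moreover have "set_borel_measurable lebesgue {c..d} f"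
  proof -
    have "set_borel_measurable lebesgue I f"
      using assms(2,3) by (simp add: set_borel_measurable_def borel_measurable_restrict_space_iff)
    then show ?thesis
      by (rule set_borel_measurable_subset) (use cd in auto)
  qed
  ultimately show "set_integrable lebesgue {c..d} f"
  proof (rule set_integrable_bound)
    show "AE t in lebesgue. t \<in> {c..d} \<longrightarrow> norm (f t) \<le> norm (B * k t)"
      using B by (intro AE_I2 impI) (metis abs_ge_self order_trans real_norm_def)
  qed
qed

lemma closed_segment_in_interval:
  fixes I :: "real set"
  assumes "is_interval I" "p \<in> I" "q \<in> I"
  shows "{p..q} \<subseteq> I"
  using mem_is_interval_1_I[OF assms] by auto

text \<open>Cutting an interval where \<open>M\<close> takes the mean of its end values replaces the bound \<open>(\<Delta>M)\<^sup>2\<close> by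
  \<open>2 (\<Delta>M/2)\<^sup>2 = (\<Delta>M)\<^sup>2 / 2\<close>. Repeated bisection brings the bound down to zero. The lemma replaces the
  theorem that an absolutely continuous function with derivative zero almost everywhere is constant.\<close>

lemma eq_if_increments_le_square:
  fixes G M :: "real \<Rightarrow> real"
  assumes "p \<le> q" and M: "continuous_on {p..q} M"
    and "\<And>s t. p \<le> s \<Longrightarrow> s \<le> t \<Longrightarrow> t \<le> q \<Longrightarrow> \<bar>G t - G s\<bar> \<le> (M t - M s)\<^sup>2"
  shows "G p = G q"
proof -
  have *: "\<bar>G t - G s\<bar> \<le> (M t - M s)\<^sup>2 / 2 ^ n" if "p \<le> s" "s \<le> t" "t \<le> q" for s t n
    using that
  proof (induction n arbitrary: s t)
    case 0
    then show ?case using assms(3) by simp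
  next
    case (Suc n)
    have cont: "continuous_on {s..t} M" using M by (rule continuous_on_subset) (use Suc.prems in auto)
    obtain m where m: "s \<le> m" "m \<le> t" "M m = (M s + M t) / 2"
    proof (cases "M s \<le> M t")
      case True
      then show thesis using IVT'[of M s "(M s + M t) / 2" t] Suc.prems cont that by auto
    next
      case False
      then show thesis using IVT2'[of M t "(M s + M t) / 2" s] Suc.prems cont that by auto
    qed
    have "\<bar>G m - G s\<bar> \<le> (M m - M s)\<^sup>2 / 2 ^ n" "\<bar>G t - G m\<bar> \<le> (M t - M m)\<^sup>2 / 2 ^ n"
      using Suc.IH[of s m] Suc.IH[of m t] m(1,2) Suc.prems by auto
    then have "\<bar>G t - G s\<bar> \<le> ((M m - M s)\<^sup>2 + (M t - M m)\<^sup>2) / 2 ^ n"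
      by (auto simp: add_divide_distrib)
    also have "(M m - M s)\<^sup>2 + (M t - M m)\<^sup>2 = (M t - M s)\<^sup>2 / 2"
      unfolding m(3) by (simp add: power2_eq_square field_simps)
    finally show ?case by (simp add: mult.commute)
  qed
  have "(\<lambda>n. (M q - M p)\<^sup>2 * (1/2) ^ n) \<longlonglongrightarrow> (M q - M p)\<^sup>2 * 0"
    by (intro tendsto_mult tendsto_const LIMSEQ_realpow_zero) auto
  then have "\<bar>G q - G p\<bar> \<le> 0"
    using *[of p q] \<open>p \<le> q\<close> by (intro LIMSEQ_le_const) (auto simp: power_divide)
  then show ?thesis by simp
qed

context
  fixes I :: "real set"
  assumes I: "is_interval I"
begin

lemma oint_add:
  assumes "f \<in> L1loc I" "g \<in> L1loc I" "p \<in> I" "q \<in> I"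
  shows "oint (\<lambda>t. f t + g t) p q = oint f p q + oint g p q"
proof -
  have *: "oint (\<lambda>t. f t + g t) p q = oint f p q + oint g p q" if "p \<le> q" "p \<in> I" "q \<in> I" for p q
    using that assms(1,2) closed_segment_in_interval[OF I, of p q]
    by (simp add: oint_eq_set_integral L1loc_integrable)
  show ?thesis
    using *[of p q] *[of q p] assms 
    by (cases "p \<le> q") (auto simp: oint_swap[of p q])
qed

lemma oint_bounded_linear:
  fixes T :: "'b::{banach, second_countable_topology} \<Rightarrow> 'c::{banach, second_countable_topology}"
  assumes T: "bounded_linear T" and "f \<in> L1loc I" "p \<in> I" "q \<in> I"
  shows "oint (\<lambda>t. T (f t)) p q = T (oint f p q)"
proof -
  have *: "oint (\<lambda>t. T (f t)) p q = T (oint f p q)" if "p \<le> q" "p \<in> I" "q \<in> I" for p q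
    using that assms(1,2) closed_segment_in_interval[OF I, of p q]
    by (simp add: oint_eq_set_integral L1loc_integrable set_integrable_bounded_linear)
  show ?thesis
    using *[of p q] *[of q p] assms(3,4)
    by (cases "p \<le> q") (simp_all add: oint_swap[of p q] linear_neg[OF bounded_linear.linear[OF T]])
qed

lemma oint_diff:
  assumes "f \<in> L1loc I" "g \<in> L1loc I" "p \<in> I" "q \<in> I"
  shows "oint (\<lambda>t. f t - g t) p q = oint f p q - oint g p q"
  using oint_add[OF assms(1) L1loc_scaleR[OF assms(2), of "-1"] assms(3,4)]
    oint_bounded_linear[OF bounded_linear_scaleR_right[of "-1"] assms(2-4)]
  by simp

lemma oint_combine:
  assumes f: "f \<in> L1loc I" and "p \<in> I" "q \<in> I" "r \<in> I"
  shows "oint f p q + oint f q r = oint f p r"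
proof -
  have *: "oint f p q + oint f q r = oint f p r" if "p \<le> q" "q \<le> r" "p \<in> I" "q \<in> I" "r \<in> I" for p q r
  proof -
    have "(LINT t:{p..q} \<union> {q..r}|lebesgue. f t) =
      (LINT t:{p..q}|lebesgue. f t) + (LINT t:{q..r}|lebesgue. f t)"
    proof (rule set_integral_Un_AE)
      have "AE x in lebesgue. x \<noteq> q" by (rule AE_I[where N="{q}"]) auto
      then show "AE x in lebesgue. \<not> (x \<in> {p..q} \<and> x \<in> {q..r})"
        by eventually_elim auto
    qed (use that closed_segment_in_interval[OF I] f in \<open>auto intro: L1loc_integrable\<close>)
    moreover have "{p..q} \<union> {q..r} = {p..r}" using that by auto
    ultimately show ?thesis using that by (simp add: oint_eq_set_integral)
  qed
  note rev = oint_swap[of p q f] oint_swap[of p r f] oint_swap[of q r f]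
  consider "p \<le> q" "q \<le> r" | "p \<le> r" "r \<le> q" | "q \<le> p" "p \<le> r" | "q \<le> r" "r \<le> p"
    | "r \<le> p" "p \<le> q" | "r \<le> q" "q \<le> p" by linarith
  then show ?thesis
  proof cases
    case 1 then show ?thesis using *[of p q r] assms by simp
  next
    case 2 then show ?thesis using *[of p r q, symmetric] assms by (simp add: rev(3))
  next
    case 3 then show ?thesis using *[of q p r, symmetric] assms by (simp add: rev(1))
  next
    case 4 then show ?thesis using *[of q r p, symmetric] assms by (simp add: rev(1,2))
  next
    case 5 then show ?thesis using *[of r p q, symmetric] assms by (simp add: rev(2,3))
  next
    case 6 then show ?thesis using *[of r q p, symmetric] assms by (simp add: rev)
  qed
qed

lemma oint_norm_le:
  assumes f: "f \<in> L1loc I" and g: "g \<in> L1loc I" and pq: "p \<in> I" "q \<in> I"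
    and le: "\<And>t. min p q \<le> t \<Longrightarrow> t \<le> max p q \<Longrightarrow> norm (f t) \<le> g t"
  shows "norm (oint f p q) \<le> \<bar>oint g p q\<bar>"
proof -
  have *: "norm (oint f p q) \<le> \<bar>oint g p q\<bar>"
    if "p \<le> q" "p \<in> I" "q \<in> I" and le: "\<And>t. t \<in> {p..q} \<Longrightarrow> norm (f t) \<le> g t" for p q
  proof -
    note int = closed_segment_in_interval[OF I, of p q]
    have "norm (LINT t:{p..q}|lebesgue. f t) \<le> (LINT t:{p..q}|lebesgue. norm (f t))"
      using L1loc_integrable[OF f int] that by (intro set_integral_norm_bound) auto
    also have "\<dots> \<le> (LINT t:{p..q}|lebesgue. g t)"
      by (rule set_integral_mono)
        (use L1loc_integrable[OF L1loc_norm[OF f] int] L1loc_integrable[OF g int] that in auto)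
    finally show ?thesis using that by (simp add: oint_eq_set_integral)
  qed
  show ?thesis
  proof (cases "p \<le> q")
    case True
    then show ?thesis using * le pq by auto
  next
    case False
    then have "norm (oint f q p) \<le> \<bar>oint g q p\<bar>" using *[of q p] le pq by auto
    then show ?thesis by (simp add: oint_swap[of q p])
  qed
qed

lemma oint_cong_AE:
  assumes f: "f \<in> L1loc I" and g: "g \<in> L1loc I" and pq: "p \<in> I" "q \<in> I"
    and "AE t in lebesgue. t \<in> I \<longrightarrow> f t = g t"
  shows "oint f p q = oint g p q"
proof -
  have *: "oint f p q = oint g p q" if "p \<le> q" "p \<in> I" "q \<in> I" for p q
  proof -
    note int = closed_segment_in_interval[OF I, of p q]
    have "(LINT t|lebesgue. indicator {p..q} t *\<^sub>R f t) = (LINT t|lebesgue. indicator {p..q} t *\<^sub>R g t)"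
    proof (rule integral_cong_AE)
      show "AE t in lebesgue. indicator {p..q} t *\<^sub>R f t = indicator {p..q} t *\<^sub>R g t"
        using assms(5) by eventually_elim (use int that in \<open>auto simp: indicator_def\<close>)
    qed (use L1loc_integrable[OF f int] L1loc_integrable[OF g int] that in \<open>auto simp: set_integrable_def\<close>)
    then show ?thesis using that by (simp add: oint_eq_set_integral set_lebesgue_integral_def)
  qed
  show ?thesis
    using *[of p q] *[of q p] pq by (cases "p \<le> q") (auto simp: oint_swap[of p q])
qed

lemma oint_mono_segment:
  fixes k :: "real \<Rightarrow> real"
  assumes "k \<in> L1loc I" "\<And>t. t \<in> I \<Longrightarrow> 0 \<le> k t" "c \<in> I" "d \<in> I" "p \<in> {c..d}" "q \<in> {c..d}"
  shows "\<bar>oint k p q\<bar> \<le> oint k c d"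
proof -
  have nn: "0 \<le> oint k p q" if "p \<le> q" "p \<in> I" "q \<in> I" for p q
    using that assms(2) closed_segment_in_interval[OF I, of p q]
    by (auto simp: oint_eq_set_integral set_lebesgue_integral_def indicator_def intro!: Bochner_Integration.integral_nonneg)
  have mem: "p \<in> I" "q \<in> I"
    using assms(3-) closed_segment_in_interval[OF I, of c d] by auto
  have *: "\<bar>oint k p q\<bar> \<le> oint k c d" if "c \<le> p" "p \<le> q" "q \<le> d" "p \<in> I" "q \<in> I" for p q
    using oint_combine[OF assms(1), of c p q] oint_combine[OF assms(1), of c q d]
      nn[of c p] nn[of p q] nn[of q d] that assms(3,4) by auto
  show ?thesis
    using *[of p q] *[of q p] mem assms(5,6) by (cases "p \<le> q") (auto simp: oint_swap[of p q])
qed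

lemma continuous_on_oint:
  fixes f :: "real \<Rightarrow> 'b::{banach, second_countable_topology}"
  assumes f: "f \<in> L1loc I" and "open I" and p: "p \<in> I"
  shows "continuous_on I (oint f p)"
proof -
  have "isCont (oint f p) x" if "x \<in> I" for x
  proof -
    obtain e where "e > 0" "cball x e \<subseteq> I"
      using \<open>open I\<close> \<open>x \<in> I\<close> by (meson open_contains_cball)
    then have e: "e > 0" "{x-e..x+e} \<subseteq> I" by (simp_all add: cball_eq_atLeastAtMost)
    define k where "k = (\<lambda>t. norm (f t))"
    have k: "k \<in> L1loc I" unfolding k_def by (rule L1loc_norm[OF f])
    have int: "set_integrable lebesgue {x-e..x+e} k"
      using k e(2) by (rule L1loc_integrable)
    have "continuous_on {x-e..x+e} (\<lambda>y. integral {x-e..y} k)"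
      by (rule indefinite_integral_continuous_1) (rule set_lebesgue_integral_eq_integral(1)[OF int])
    then have "isCont (\<lambda>y. integral {x-e..y} k) x"
      by (rule continuous_on_interior) (use e in auto)
    then have lim: "((\<lambda>y. integral {x-e..y} k - integral {x-e..x} k) \<longlongrightarrow> 0) (at x)"
      by (simp add: isCont_def LIM_zero)
    have "\<forall>\<^sub>F y in at x. norm (oint f p y - oint f p x) \<le> \<bar>integral {x-e..y} k - integral {x-e..x} k\<bar>"
    proof -
      have "norm (oint f p y - oint f p x) \<le> \<bar>integral {x-e..y} k - integral {x-e..x} k\<bar>"
        if "dist y x < e" for y
      proof -
        have y: "y \<in> {x-e..x+e}" using that by (auto simp: dist_real_def)
        have mem: "y \<in> I" "x - e \<in> I" using e y by auto
        have "oint k (x-e) w = integral {x-e..w} k" if "w \<in> {x-e..x+e}" for w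
        proof -
          have "set_integrable lebesgue {x-e..w} k"
            by (rule set_integrable_subset[OF int]) (use that in auto)
          then show ?thesis
            using that by (simp add: oint_eq_set_integral set_lebesgue_integral_eq_integral(2))
        qed
        from this[of x] this[of y] have "integral {x-e..y} k - integral {x-e..x} k = oint k x y"
          using e(1) y oint_combine[OF k \<open>x - e \<in> I\<close> \<open>x \<in> I\<close> \<open>y \<in> I\<close>] by simp
        moreover have "oint f p y - oint f p x = oint f x y"
          using oint_combine[OF f p \<open>x \<in> I\<close> \<open>y \<in> I\<close>] by (simp add: algebra_simps)
        moreover have "norm (oint f x y) \<le> \<bar>oint k x y\<bar>"
          by (rule oint_norm_le[OF f k \<open>x \<in> I\<close> \<open>y \<in> I\<close>]) (simp add: k_def)
        ultimately show ?thesis by simp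
      qed
      then show ?thesis
        unfolding eventually_at using e(1) by (intro exI[of _ e]) auto
    qed
    then have "((\<lambda>y. oint f p y - oint f p x) \<longlongrightarrow> 0) (at x)"
      by (rule Lim_null_comparison) (use tendsto_rabs_zero[OF lim] in simp)
    then show ?thesis by (simp add: isCont_def LIM_zero_iff)
  qed
  then show ?thesis by (simp add: continuous_at_imp_continuous_on)
qed

section \<open>A substitution rule and the exponential weight\<close>

text \<open>The chain rule for \<open>exp (l K)\<close>, where \<open>K\<close> is the indefinite integral of a function \<open>k \<ge> 0\<close> that is
  integrable but in general not continuous, so that \<open>K\<close> is not a \<open>C\<^sup>1\<close> function. On a subinterval, both
  \<open>l \<integral> k exp (l K)\<close> and the increment of \<open>exp (l K)\<close> differ from \<open>l exp (l K(s)) \<Delta>K\<close> by at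
  most \<open>\<bar>l\<bar> \<Delta>K\<close> times the absolute increment of the monotone function \<open>exp (l K)\<close>. Their difference is thus
  quadratically small in the sense of \<open>eq_if_increments_le_square\<close>.\<close>

lemma oint_mult_exp:
  fixes k K :: "real \<Rightarrow> real" and l :: real
  assumes k: "k \<in> L1loc I" "\<And>t. t \<in> I \<Longrightarrow> 0 \<le> k t" and kK: "(\<lambda>t. k t * exp (l * K t)) \<in> L1loc I"
    and K: "continuous_on I K" "\<And>s t. s \<in> I \<Longrightarrow> t \<in> I \<Longrightarrow> K t - K s = oint k s t"
    and pq: "p \<in> I" "q \<in> I" "p \<le> q"
  shows "l * oint (\<lambda>t. k t * exp (l * K t)) p q = exp (l * K q) - exp (l * K p)"
proof -
  define f where "f = (\<lambda>t. k t * exp (l * K t))"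
  define G where "G = (\<lambda>x. l * oint f p x - exp (l * K x))"
  \<comment> \<open>\<open>sgn l * exp (l * K x)\<close> increases with \<open>x\<close> for either sign of \<open>l\<close>.\<close>
  define M where "M = (\<lambda>x. \<bar>l\<bar> * K x + sgn l * exp (l * K x))"
  note sub = closed_segment_in_interval[OF I pq(1,2)]
  have mono: "K s \<le> K t" if "s \<in> I" "t \<in> I" "s \<le> t" for s t
    using oint_mono_segment[OF k that(1,2), of s t] K(2)[OF that(1,2)] that by auto
  have "G p = G q"
  proof (rule eq_if_increments_le_square[OF pq(3), of M])
    show "continuous_on {p..q} M"
      unfolding M_def by (intro continuous_intros continuous_on_subset[OF K(1) sub])
    fix s t assume st: "p \<le> s" "s \<le> t" "t \<le> q"
    then have mem: "s \<in> I" "t \<in> I" using sub by auto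
    let ?D = "sgn l * (exp (l * K t) - exp (l * K s))" and ?d = "\<bar>l\<bar> * (K t - K s)"
    let ?lo = "min (exp (l * K s)) (exp (l * K t))" and ?hi = "max (exp (l * K s)) (exp (l * K t))"
    have Kst: "K s \<le> K t" using mono mem st by auto
    have between: "?lo \<le> exp (l * K r) \<and> exp (l * K r) \<le> ?hi" if "s \<le> r" "r \<le> t" for r
    proof -
      have "r \<in> I" using that st sub by auto
      then have "K s \<le> K r" "K r \<le> K t" using mono mem that by auto
      then show ?thesis
        by (cases "l \<ge> 0") (auto simp: min_def max_def mult_left_mono mult_left_mono_neg)
    qed
    have "norm (oint (\<lambda>r. f r - exp (l * K s) * k r) s t) \<le> \<bar>oint (\<lambda>r. (?hi - ?lo) * k r) s t\<bar>"
    proof (rule oint_norm_le)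
      show "(\<lambda>r. f r - exp (l * K s) * k r) \<in> L1loc I"
        using L1loc_diff[OF kK L1loc_scaleR[OF k(1)]] by (simp add: f_def)
      show "(\<lambda>r. (?hi - ?lo) * k r) \<in> L1loc I"
        using L1loc_scaleR[OF k(1), of "?hi - ?lo"] by simp
      fix r assume "min s t \<le> r" "r \<le> max s t"
      then have r: "s \<le> r" "r \<le> t" using st by auto
      then have "0 \<le> k r" using k(2)[of r] st subsetD[OF sub, of r] by auto
      have "f r - exp (l * K s) * k r = k r * (exp (l * K r) - exp (l * K s))"
        by (simp add: f_def algebra_simps)
      moreover have "\<bar>exp (l * K r) - exp (l * K s)\<bar> \<le> ?hi - ?lo"
        using between[OF r] by linarith
      ultimately show "norm (f r - exp (l * K s) * k r) \<le> (?hi - ?lo) * k r"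
        using mult_left_mono[of "\<bar>exp (l * K r) - exp (l * K s)\<bar>" "?hi - ?lo", OF _ \<open>0 \<le> k r\<close>] \<open>0 \<le> k r\<close>
          by (simp only: abs_mult real_norm_def abs_of_nonneg mult.commute[of _ "k r"])
    qed (use mem in auto)
    also have "\<dots> = (?hi - ?lo) * (K t - K s)"
      using Kst K(2)[OF mem] by (simp add: abs_mult min_def max_def)
    also have "oint (\<lambda>r. f r - exp (l * K s) * k r) s t = oint f s t - exp (l * K s) * (K t - K s)"
      using oint_diff[OF kK L1loc_scaleR[OF k(1)] mem] K(2)[OF mem] by (simp add: f_def)
    finally have 1: "\<bar>oint f s t - exp (l * K s) * (K t - K s)\<bar> \<le> (?hi - ?lo) * (K t - K s)" by simp
    show "\<bar>G t - G s\<bar> \<le> (M t - M s)\<^sup>2"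
    proof -
      define a where "a = l * (K t - K s)"
      \<comment> \<open>For either sign of \<open>a\<close>, the estimate \<open>exp1\<close> below amounts to \<open>exp a * (1 - a) \<le> 1\<close>.\<close>
      have "exp a * (1 - a) \<le> exp a * exp (- a)"
        using exp_ge_add_one_self[of "- a"] by (intro mult_left_mono) auto
      then have "exp a * (1 - a) \<le> 1" by (simp flip: exp_add)
      then have exp1: "\<bar>exp a - 1 - a\<bar> \<le> \<bar>a\<bar> * \<bar>exp a - 1\<bar>"
        using exp_ge_add_one_self[of a] by (cases "a \<ge> 0") (auto simp: abs_mult algebra_simps)
      have E: "exp (l * K t) = exp (l * K s) * exp a"
        unfolding a_def by (simp add: algebra_simps flip: exp_add)
      have "\<bar>exp (l * K t) - exp (l * K s) - exp (l * K s) * a\<bar> = exp (l * K s) * \<bar>exp a - 1 - a\<bar>"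
        using abs_mult[of "exp (l * K s)" "exp a - 1 - a"] unfolding E by (simp add: right_diff_distrib)
      also have "\<dots> \<le> exp (l * K s) * (\<bar>a\<bar> * \<bar>exp a - 1\<bar>)"
        using exp1 by (rule mult_left_mono) simp
      also have "\<dots> = \<bar>a\<bar> * \<bar>exp (l * K t) - exp (l * K s)\<bar>"
        using abs_mult[of "exp (l * K s)" "exp a - 1"] unfolding E by (simp add: right_diff_distrib)
      also have "\<bar>exp (l * K t) - exp (l * K s)\<bar> = ?hi - ?lo"
        by linarith
      also have "\<bar>a\<bar> * (?hi - ?lo) = ?d * (?hi - ?lo)"
        using Kst by (simp add: a_def abs_mult)
      finally have 2: "\<bar>exp (l * K t) - exp (l * K s) - exp (l * K s) * a\<bar> \<le> ?d * (?hi - ?lo)" .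
      have "\<bar>l * (oint f s t - exp (l * K s) * (K t - K s))\<bar> \<le> \<bar>l\<bar> * ((?hi - ?lo) * (K t - K s))"
        unfolding abs_mult by (rule mult_left_mono[OF 1]) simp
      then have 3: "\<bar>l * oint f s t - exp (l * K s) * a\<bar> \<le> ?d * (?hi - ?lo)"
        by (simp add: a_def algebra_simps)
      have "G t - G s = l * oint f s t - (exp (l * K t) - exp (l * K s))"
        unfolding G_def f_def oint_combine[OF kK pq(1) mem, symmetric] by (simp add: distrib_left)
      then have "\<bar>G t - G s\<bar> \<le> 2 * ?d * (?hi - ?lo)" using 2 3 by linarith
      also have "\<dots> \<le> (?d + (?hi - ?lo))\<^sup>2"
        by (simp add: power2_sum)
      also have "?hi - ?lo = sgn l * (exp (l * K t) - exp (l * K s))"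
      proof (cases "l \<ge> 0")
        case True
        then show ?thesis using Kst by (cases "l = 0") (auto simp: mult_left_mono min_def max_def)
      next
        case False
        then show ?thesis using Kst by (auto simp: mult_left_mono_neg min_def max_def)
      qed
      also have "?d + \<dots> = M t - M s" by (simp add: M_def algebra_simps)
      finally show ?thesis .
    qed
  qed
  then show ?thesis by (simp add: G_def f_def)
qed

text \<open>Multiplying the weight \<open>exp (2 \<bar>K\<bar>)\<close> by \<open>k\<close> and integrating from \<open>x\<^sub>0\<close> gains the factor \<open>1/2\<close>. The
  absolute value of \<open>K\<close> covers both sides of \<open>x\<^sub>0\<close>: to the left of \<open>x\<^sub>0\<close> one has \<open>\<bar>K\<bar> = -K\<close>, and the chain
  rule is applied with \<open>l = -2\<close>.\<close>

lemma oint_exp_weight_le: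
  fixes k :: "real \<Rightarrow> real" and x\<^sub>0 :: real
  defines "K \<equiv> oint k x\<^sub>0"
  assumes k: "k \<in> L1loc I" "\<And>t. t \<in> I \<Longrightarrow> 0 \<le> k t" and "open I" and x: "x\<^sub>0 \<in> I" "x \<in> I"
  shows "\<bar>oint (\<lambda>t. k t * exp (2 * \<bar>K t\<bar>)) x\<^sub>0 x\<bar> \<le> (exp (2 * \<bar>K x\<bar>) - 1) / 2"
proof -
  have contK: "continuous_on I K"
    unfolding K_def by (rule continuous_on_oint[OF k(1) \<open>open I\<close> x(1)])
  have incr: "K t - K s = oint k s t" if "s \<in> I" "t \<in> I" for s t
    using oint_combine[OF k(1) x(1) that] by (simp add: K_def)
  have L1: "(\<lambda>t. k t * exp (l * K t)) \<in> L1loc I" for l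
    by (intro L1loc_mult_continuous[OF k(1)] continuous_intros contK)
  have ftc: "l * oint (\<lambda>t. k t * exp (l * K t)) p q = exp (l * K q) - exp (l * K p)"
    if "p \<in> I" "q \<in> I" "p \<le> q" for l p q
    by (rule oint_mult_exp) (use k L1 contK incr that in auto)
  have nonneg: "0 \<le> oint k s t" if "s \<in> I" "t \<in> I" "s \<le> t" for s t
    using oint_mono_segment[OF k that(1,2), of s t] that by auto
  have K0: "K x\<^sub>0 = 0" by (simp add: K_def)
  have arith: "\<bar>X\<bar> \<le> (E - 1) / 2" if "2 * X = E - 1" "1 \<le> E" for X E :: real
    using that by (simp add: abs_if)
  show ?thesis
  proof (cases "x\<^sub>0 \<le> x")
    case True
    have pos: "0 \<le> K t" if "x\<^sub>0 \<le> t" "t \<le> x" for t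
      using nonneg[of x\<^sub>0 t] that x closed_segment_in_interval[OF I x] by (auto simp: K_def)
    have "oint (\<lambda>t. k t * exp (2 * \<bar>K t\<bar>)) x\<^sub>0 x = oint (\<lambda>t. k t * exp (2 * K t)) x\<^sub>0 x"
      by (rule oint_cong) (use True pos in auto)
    moreover have "1 \<le> exp (2 * K x)" and "\<bar>K x\<bar> = K x" using pos[of x] True by simp_all
    moreover have "2 * oint (\<lambda>t. k t * exp (2 * K t)) x\<^sub>0 x = exp (2 * K x) - 1"
      using ftc[OF x True, of 2] K0 by simp
    ultimately show ?thesis by (simp only: arith)
  next
    case False
    then have le: "x \<le> x\<^sub>0" by simp
    have neg: "K t \<le> 0" if "x \<le> t" "t \<le> x\<^sub>0" for t
      using nonneg[of t x\<^sub>0] that x closed_segment_in_interval[OF I x(2,1)] incr[of t x\<^sub>0] K0 by auto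
    have "oint (\<lambda>t. k t * exp (2 * \<bar>K t\<bar>)) x\<^sub>0 x = oint (\<lambda>t. k t * exp (-2 * K t)) x\<^sub>0 x"
      by (rule oint_cong) (use le neg in auto)
    also have "\<dots> = - oint (\<lambda>t. k t * exp (-2 * K t)) x x\<^sub>0"
      by (rule oint_swap)
    finally have "oint (\<lambda>t. k t * exp (2 * \<bar>K t\<bar>)) x\<^sub>0 x = - oint (\<lambda>t. k t * exp (-2 * K t)) x x\<^sub>0" .
    moreover have "1 \<le> exp (-2 * K x)" and "2 * \<bar>K x\<bar> = -2 * K x" using neg[of x] le by simp_all
    moreover have "-2 * oint (\<lambda>t. k t * exp (-2 * K t)) x x\<^sub>0 = 1 - exp (-2 * K x)"
      using ftc[OF x(2,1) le, of "-2"] K0 by simp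
    ultimately show ?thesis by (simp only: abs_minus_cancel) (rule arith, simp_all)
  qed
qed

end

section \<open>Linear integral equations with locally integrable coefficients\<close>

text \<open>For a simple function \<open>s\<close>, the map \<open>t \<mapsto> A t (s t)\<close> is glued from finitely many of the measurable
  functions \<open>A \<cdot> v\<close>. A measurable \<open>u\<close> is a pointwise limit of simple functions, and continuity of each
  \<open>A t\<close> carries the limit over.\<close>

lemma borel_measurable_apply_Caratheodory:
  fixes A :: "'t \<Rightarrow> 'b::{metric_space, second_countable_topology} \<Rightarrow> 'c::{metric_space, second_countable_topology}"
  assumes u: "u \<in> borel_measurable M" and A: "\<And>v. (\<lambda>t. A t v) \<in> borel_measurable M"
    and cont: "\<And>t. t \<in> space M \<Longrightarrow> continuous_on UNIV (A t)"
  shows "(\<lambda>t. A t (u t)) \<in> borel_measurable M"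
proof -
  from borel_measurable_implies_sequence_metric[OF u]
  obtain s where "\<forall>i. simple_function M (s i)" "\<forall>t\<in>space M. (\<lambda>i. s i t) \<longlonglongrightarrow> u t"
    by blast
  then have s: "\<And>i. simple_function M (s i)" "\<And>t. t \<in> space M \<Longrightarrow> (\<lambda>i. s i t) \<longlonglongrightarrow> u t"
    by auto
  show ?thesis
  proof (rule borel_measurable_LIMSEQ_metric)
    fix i
    have fin: "finite (s i ` space M)" using s(1) by (simp add: simple_function_def)
    have "s i \<in> measurable M (count_space (s i ` space M))"
      using s(1)[of i] unfolding measurable_count_space_eq2[OF fin]
      by (auto simp: simple_function_def)
    then show "(\<lambda>t. A t (s i t)) \<in> borel_measurable M"
      by (intro measurable_compose_countable'[OF A _ countable_finite[OF fin]])
  next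
    fix t assume "t \<in> space M"
    then show "(\<lambda>i. A t (s i t)) \<longlonglongrightarrow> A t (u t)"
      using cont s(2) by (intro isCont_tendsto_compose[of _ "A t"]) (simp_all add: continuous_on_eq_continuous_at)
  qed
qed

text \<open>The coefficient \<open>A\<close> is only strongly measurable: \<open>A \<cdot> v\<close> is measurable for each vector \<open>v\<close>, while
  \<open>A\<close> itself need not be measurable in operator norm.\<close>

locale linear_integral_equation =
  fixes I :: "real set" and x\<^sub>0 :: real and k :: "real \<Rightarrow> real"
    and A :: "real \<Rightarrow> 'x::{banach, second_countable_topology} \<Rightarrow> 'x"
  assumes interval: "is_interval I" and openI: "open I" and x0: "x\<^sub>0 \<in> I"
    and k_L1: "k \<in> L1loc I" and k_nonneg: "\<And>t. t \<in> I \<Longrightarrow> 0 \<le> k t"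
    and A_linear: "\<And>t. t \<in> I \<Longrightarrow> linear (A t)"
    and A_bound: "\<And>t v. t \<in> I \<Longrightarrow> norm (A t v) \<le> k t * norm v"
    and A_meas: "\<And>v. (\<lambda>t. A t v) \<in> borel_measurable (lebesgue_on I)"
begin

lemma bounded_linear_A: "t \<in> I \<Longrightarrow> bounded_linear (A t)"
  using A_linear A_bound
  by (auto simp: bounded_linear_def bounded_linear_axioms_def intro!: exI[of _ "k t"] simp: mult.commute)

definition weight :: "real \<Rightarrow> real" where
  "weight x = exp (2 * \<bar>oint k x\<^sub>0 x\<bar>)"

lemma weight_ge_1: "1 \<le> weight x"
  by (simp add: weight_def)

lemma continuous_on_weight: "continuous_on I weight"
  unfolding weight_def
  by (intro continuous_intros continuous_on_oint[OF interval k_L1 openI x0])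

lemma between_mem:
  assumes x: "x \<in> I" and "min x\<^sub>0 x \<le> t" "t \<le> max x\<^sub>0 x"
  shows "t \<in> I"
  using closed_segment_in_interval[OF interval x0 x] closed_segment_in_interval[OF interval x x0] assms(2,3)
  by (auto simp: min_def max_def split: if_splits)

lemma segment_subset: "c \<le> x\<^sub>0 \<Longrightarrow> x\<^sub>0 \<le> d \<Longrightarrow> x \<in> {c..d} \<Longrightarrow> min x\<^sub>0 x \<le> t \<Longrightarrow> t \<le> max x\<^sub>0 x \<Longrightarrow> t \<in> {c..d}"
  by (auto simp: min_def max_def split: if_splits)

lemma enclosing_segment:
  assumes "x \<in> I"
  obtains c d where "{c..d} \<subseteq> I" "c \<le> x\<^sub>0" "x\<^sub>0 \<le> d" "c < x" "x < d"
proof -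
  obtain e where "e > 0" "cball x e \<subseteq> I" using openI assms by (meson open_contains_cball)
  then have e: "e > 0" "x - e \<in> I" "x + e \<in> I" by (auto simp: subset_iff dist_real_def)
  have sub: "{min x\<^sub>0 (x-e)..max x\<^sub>0 (x+e)} \<subseteq> I"
    by (rule closed_segment_in_interval[OF interval]) (use e x0 in \<open>auto simp: min_def max_def\<close>)
  show thesis by (rule that[OF sub]) (use e(1) in auto)
qed

lemma A_comp_L1loc:
  assumes u: "continuous_on I u"
  shows "(\<lambda>t. A t (u t)) \<in> L1loc I"
proof (rule L1loc_dominated[OF k_L1])
  show "(\<lambda>t. A t (u t)) \<in> borel_measurable (lebesgue_on I)"
  proof (rule borel_measurable_apply_Caratheodory[OF _ A_meas])
    show "u \<in> borel_measurable (lebesgue_on I)"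
      by (rule continuous_imp_measurable_on_sets_lebesgue[OF u]) (use openI in auto)
    show "continuous_on UNIV (A t)" if "t \<in> space (lebesgue_on I)" for t
      using bounded_linear_A[of t] that by (auto intro: linear_continuous_on)
  qed
  show "I \<in> sets lebesgue" using openI by auto
  fix c d assume cd: "{c..d} \<subseteq> I"
  have "bounded (u ` {c..d})"
    using continuous_on_subset[OF u cd] by (intro compact_imp_bounded compact_continuous_image) auto
  then obtain B where B: "\<And>t. t \<in> {c..d} \<Longrightarrow> norm (u t) \<le> B"
    unfolding bounded_iff by blast
  have "norm (A t (u t)) \<le> B * k t" if "t \<in> {c..d}" for t
  proof -
    have "t \<in> I" using that cd by auto
    then have "norm (A t (u t)) \<le> k t * norm (u t)" by (rule A_bound)
    also have "\<dots> \<le> k t * B" using B[OF that] k_nonneg[OF \<open>t \<in> I\<close>] by (rule mult_left_mono)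
    finally show ?thesis by (simp add: mult.commute)
  qed
  then show "\<exists>B. \<forall>t\<in>{c..d}. norm (A t (u t)) \<le> B * k t" by blast
qed

lemma k_mult_weight_L1loc: "(\<lambda>t. C * (k t * weight t)) \<in> L1loc I"
  using L1loc_scaleR[OF L1loc_mult_continuous[OF k_L1 continuous_on_weight], of C] by simp

lemma oint_k_weight_le:
  assumes "x \<in> I" "0 \<le> C"
  shows "\<bar>oint (\<lambda>t. C * (k t * weight t)) x\<^sub>0 x\<bar> \<le> C * ((weight x - 1) / 2)"
proof -
  have "\<bar>oint (\<lambda>t. k t * weight t) x\<^sub>0 x\<bar> \<le> (weight x - 1) / 2"
    unfolding weight_def by (rule oint_exp_weight_le[OF interval k_L1 k_nonneg openI x0 assms(1)])
  then show ?thesis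
    using mult_left_mono[OF _ assms(2)] assms(2) by (simp only: interval_lebesgue_integral_mult_right abs_mult abs_of_nonneg)
qed

text \<open>The contraction property: in the norm \<open>sup (\<parallel>u\<parallel> / weight)\<close> the integral operator has norm at
  most \<open>1/2\<close>. The sharper \<open>weight x - 1\<close> in place of \<open>weight x\<close> leaves room for the inhomogeneous term in the
  Gronwall estimate.\<close>

lemma oint_A_le:
  assumes u: "continuous_on I u" and x: "x \<in> I" and C: "0 \<le> C"
    and le: "\<And>t. min x\<^sub>0 x \<le> t \<Longrightarrow> t \<le> max x\<^sub>0 x \<Longrightarrow> norm (u t) \<le> C * weight t"
  shows "norm (oint (\<lambda>t. A t (u t)) x\<^sub>0 x) \<le> C * ((weight x - 1) / 2)"
proof -
  have "norm (oint (\<lambda>t. A t (u t)) x\<^sub>0 x) \<le> \<bar>oint (\<lambda>t. C * (k t * weight t)) x\<^sub>0 x\<bar>"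
  proof (rule oint_norm_le[OF interval A_comp_L1loc[OF u] k_mult_weight_L1loc x0 x])
    fix t assume t: "min x\<^sub>0 x \<le> t" "t \<le> max x\<^sub>0 x"
    then have tI: "t \<in> I"
      by (rule between_mem[OF x])
    have "norm (A t (u t)) \<le> k t * norm (u t)" using tI by (rule A_bound)
    also have "\<dots> \<le> k t * (C * weight t)" using le[OF t] k_nonneg[OF tI] by (rule mult_left_mono)
    finally show "norm (A t (u t)) \<le> C * (k t * weight t)" by (simp add: algebra_simps)
  qed
  also have "\<dots> \<le> C * ((weight x - 1) / 2)" using x C by (rule oint_k_weight_le)
  finally show ?thesis .
qed

definition solves :: "(real \<Rightarrow> 'x) \<Rightarrow> (real \<Rightarrow> 'x) \<Rightarrow> bool" where
  "solves v u \<longleftrightarrow> continuous_on I u \<and> (\<forall>x\<in>I. u x = v x + oint (\<lambda>t. A t (u t)) x\<^sub>0 x)"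

lemma solves_continuous: "solves v u \<Longrightarrow> continuous_on I u"
  by (simp only: solves_def)

lemma solves_eq: "solves v u \<Longrightarrow> x \<in> I \<Longrightarrow> u x = v x + oint (\<lambda>t. A t (u t)) x\<^sub>0 x"
  by (simp only: solves_def)

lemma solves_cong:
  assumes "solves v u" "\<And>x. x \<in> I \<Longrightarrow> v x = v' x" "\<And>x. x \<in> I \<Longrightarrow> u x = u' x"
  shows "solves v' u'"
proof -
  have "oint (\<lambda>t. A t (u' t)) x\<^sub>0 x = oint (\<lambda>t. A t (u t)) x\<^sub>0 x" if "x \<in> I" for x
    by (rule oint_cong) (simp add: assms(3) between_mem[OF that])
  moreover have "continuous_on I u' \<longleftrightarrow> continuous_on I u"
    by (rule continuous_on_cong) (auto simp: assms(3))
  moreover note solves_continuous[OF assms(1)] solves_eq[OF assms(1)]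
  ultimately show ?thesis
    unfolding solves_def by (metis assms(2,3))
qed

lemma solves_add:
  assumes "solves v u" "solves v' u'"
  shows "solves (\<lambda>x. v x + v' x) (\<lambda>x. u x + u' x)"
proof -
  have cont: "continuous_on I u" "continuous_on I u'" using assms by (auto simp: solves_def)
  have "oint (\<lambda>t. A t (u t + u' t)) x\<^sub>0 x = oint (\<lambda>t. A t (u t)) x\<^sub>0 x + oint (\<lambda>t. A t (u' t)) x\<^sub>0 x"
    if "x \<in> I" for x
  proof -
    have "oint (\<lambda>t. A t (u t + u' t)) x\<^sub>0 x = oint (\<lambda>t. A t (u t) + A t (u' t)) x\<^sub>0 x"
    proof (rule oint_cong)
      fix t assume "min x\<^sub>0 x \<le> t" "t \<le> max x\<^sub>0 x"
      then have "t \<in> I"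
        by (rule between_mem[OF that])
      then show "A t (u t + u' t) = A t (u t) + A t (u' t)"
        by (rule linear_add[OF A_linear])
    qed
    then show ?thesis
      using oint_add[OF interval A_comp_L1loc[OF cont(1)] A_comp_L1loc[OF cont(2)] x0 that] by simp
  qed
  then show ?thesis
    using assms by (auto simp: solves_def intro: continuous_on_add)
qed

text \<open>This transports solutions along symmetries of the equation; real and complex multiples are
  the instances that matter.\<close>

lemma solves_bounded_linear:
  assumes "solves v u" and T: "bounded_linear T"
    and comm: "\<And>t v. t \<in> I \<Longrightarrow> A t (T v) = T (A t v)"
  shows "solves (\<lambda>x. T (v x)) (\<lambda>x. T (u x))"
proof -
  have cont: "continuous_on I u" using assms by (auto simp: solves_def)
  have "oint (\<lambda>t. A t (T (u t))) x\<^sub>0 x = T (oint (\<lambda>t. A t (u t)) x\<^sub>0 x)" if "x \<in> I" for x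
  proof -
    have "oint (\<lambda>t. A t (T (u t))) x\<^sub>0 x = oint (\<lambda>t. T (A t (u t))) x\<^sub>0 x"
    proof (rule oint_cong)
      fix t assume "min x\<^sub>0 x \<le> t" "t \<le> max x\<^sub>0 x"
      then have "t \<in> I"
        by (rule between_mem[OF that])
      then show "A t (T (u t)) = T (A t (u t))" by (rule comm)
    qed
    then show ?thesis
      using oint_bounded_linear[OF interval T A_comp_L1loc[OF cont] x0 that] by simp
  qed
  then show ?thesis
    using assms(1) bounded_linear.continuous_on[OF T cont] linear_add[OF bounded_linear.linear[OF T]]
    by (auto simp: solves_def)
qed

lemma solves_scaleR: "solves v u \<Longrightarrow> solves (\<lambda>x. r *\<^sub>R v x) (\<lambda>x. r *\<^sub>R u x)"
  by (rule solves_bounded_linear) (auto simp: bounded_linear_scaleR_right linear_cmul[OF A_linear])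

lemma solves_diff:
  assumes "solves v u" "solves v' u'"
  shows "solves (\<lambda>x. v x - v' x) (\<lambda>x. u x - u' x)"
  using solves_add[OF assms(1) solves_scaleR[OF assms(2), of "-1"]] by simp

text \<open>Gronwall's inequality. A crude bound \<open>B\<close> for \<open>u\<close> exists on the compact interval. Inserting a
  bound of the form \<open>(2 M + B / 2\<^sup>n) weight\<close> into the equation yields the same bound with \<open>n + 1\<close> in place of \<open>n\<close>, so
  that \<open>B\<close> disappears in the limit.\<close>

lemma solves_norm_le:
  assumes u: "solves v u" and S: "{c..d} \<subseteq> I" "c \<le> x\<^sub>0" "x\<^sub>0 \<le> d"
    and v: "\<And>t. t \<in> {c..d} \<Longrightarrow> norm (v t) \<le> M" and x: "x \<in> {c..d}"
  shows "norm (u x) \<le> 2 * M * weight x"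
proof -
  have cont: "continuous_on I u" using u by (auto simp: solves_def)
  have M: "0 \<le> M" using norm_ge_zero[of "v x"] v[OF x] by linarith
  have "bounded (u ` {c..d})"
    using continuous_on_subset[OF cont S(1)] by (intro compact_imp_bounded compact_continuous_image) auto
  then obtain B where B: "\<And>t. t \<in> {c..d} \<Longrightarrow> norm (u t) \<le> B"
    unfolding bounded_iff by blast
  have B0: "0 \<le> B" using norm_ge_zero[of "u x"] B[OF x] by linarith
  have *: "norm (u x) \<le> (2 * M + B * (1/2) ^ n) * weight x" if "x \<in> {c..d}" for n x
    using that
  proof (induction n arbitrary: x)
    case 0
    have "norm (u x) \<le> 2 * M + B" using B[OF 0] M by linarith
    also have "\<dots> \<le> (2 * M + B) * weight x"
      using mult_left_mono[OF weight_ge_1, of "2 * M + B"] M B0 by simp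
    finally show ?case by simp
  next
    case (Suc n)
    let ?C = "2 * M + B * (1/2) ^ n"
    have xI: "x \<in> I" using Suc.prems S by auto
    have C: "0 \<le> ?C" using M B0 by simp
    have "norm (u x) \<le> norm (v x) + norm (oint (\<lambda>t. A t (u t)) x\<^sub>0 x)"
      using u xI norm_triangle_ineq by (simp add: solves_def)
    also have "\<dots> \<le> M + ?C * ((weight x - 1) / 2)"
      by (intro add_mono v[OF Suc.prems] oint_A_le[OF cont xI C] Suc.IH segment_subset[OF S(2,3) Suc.prems])
    also have "\<dots> = (M + B * (1/2) ^ Suc n) * weight x - B * (1/2) ^ Suc n"
      by (simp add: field_simps)
    also have "\<dots> \<le> (2 * M + B * (1/2) ^ Suc n) * weight x"
    proof -
      have "M * weight x \<ge> 0" "B * (1/2) ^ Suc n \<ge> 0" using M B0 weight_ge_1[of x] by auto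
      then show ?thesis by (simp add: algebra_simps)
    qed
    finally show ?case .
  qed
  have "(\<lambda>n. (2 * M + B * (1/2) ^ n) * weight x) \<longlonglongrightarrow> (2 * M + B * 0) * weight x"
    by (intro tendsto_intros LIMSEQ_realpow_zero) auto
  then show ?thesis
    using *[OF x] by (intro LIMSEQ_le_const) auto
qed

lemma weight_le:
  assumes "{c..d} \<subseteq> I" "c \<le> x\<^sub>0" "x\<^sub>0 \<le> d" "x \<in> {c..d}"
  shows "weight x \<le> exp (2 * oint k c d)"
proof -
  have "c \<in> I" "d \<in> I" using assms by auto
  then show ?thesis
    using oint_mono_segment[OF interval k_L1 k_nonneg, of c d x\<^sub>0 x] assms by (simp add: weight_def)
qed

lemma solves_unique:
  assumes "solves v u" "solves v' u'" "\<And>x. x \<in> I \<Longrightarrow> v x = v' x" "x \<in> I"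
  shows "u x = u' x"
proof -
  have "{min x\<^sub>0 x..max x\<^sub>0 x} \<subseteq> I"
    using closed_segment_in_interval[OF interval x0 assms(4)] closed_segment_in_interval[OF interval assms(4) x0]
    by (auto simp: min_def max_def split: if_splits)
  then have "norm (u x - u' x) \<le> 2 * 0 * weight x"
    by (rule solves_norm_le[OF solves_diff[OF assms(1,2)]]) (use assms(3) \<open>_ \<subseteq> I\<close> in auto)
  then show ?thesis by simp
qed

text \<open>The terms of the Neumann series; their sum is the solution with inhomogeneity \<open>v\<close>.\<close>

primrec picard :: "(real \<Rightarrow> 'x) \<Rightarrow> nat \<Rightarrow> real \<Rightarrow> 'x" where
  "picard v 0 = v"
| "picard v (Suc n) = (\<lambda>x. oint (\<lambda>t. A t (picard v n t)) x\<^sub>0 x)"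

lemma continuous_picard: "continuous_on I v \<Longrightarrow> continuous_on I (picard v n)"
  by (induction n) (auto intro: continuous_on_oint[OF interval A_comp_L1loc openI x0])

lemma picard_le:
  assumes "continuous_on I v" and S: "{c..d} \<subseteq> I" "c \<le> x\<^sub>0" "x\<^sub>0 \<le> d"
    and v: "\<And>t. t \<in> {c..d} \<Longrightarrow> norm (v t) \<le> M" and "x \<in> {c..d}"
  shows "norm (picard v n x) \<le> M * (1/2) ^ n * weight x"
  using \<open>x \<in> {c..d}\<close>
proof (induction n arbitrary: x)
  case 0
  have M: "0 \<le> M" using norm_ge_zero[of "v x"] v[OF 0] by linarith
  show ?case using v[OF 0] mult_left_mono[OF weight_ge_1 M, of x] by simp
next
  case (Suc n)
  have M: "0 \<le> M" using norm_ge_zero[of "v x"] v[OF Suc.prems] by linarith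
  have C: "0 \<le> M * (1/2) ^ n" using M by simp
  have "norm (picard v (Suc n) x) \<le> M * (1/2) ^ n * ((weight x - 1) / 2)"
    unfolding picard.simps
    by (intro oint_A_le[OF continuous_picard[OF assms(1)] _ C] Suc.IH segment_subset[OF S(2,3) Suc.prems])
      (use S Suc.prems in auto)
  also have "\<dots> \<le> M * (1/2) ^ Suc n * weight x" using C by (simp add: field_simps)
  finally show ?case .
qed

text \<open>The Neumann series converges uniformly on compact subintervals that contain \<open>x\<^sub>0\<close>, by
  \<open>picard_le\<close> and the boundedness of the weight there. Its terms are defined on all of \<open>I\<close>, so no
  gluing of local solutions is necessary.\<close>

lemma solves_exists:
  assumes v: "continuous_on I v"
  shows "\<exists>u. solves v u"
proof -
  define s where "s = (\<lambda>n x. \<Sum>i<n. picard v i x)"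
  define u where "u = (\<lambda>x. \<Sum>i. picard v i x)"
  have unif: "uniform_limit {c..d} s u sequentially"
    if S: "{c..d} \<subseteq> I" "c \<le> x\<^sub>0" "x\<^sub>0 \<le> d" for c d
  proof -
    have "bounded (v ` {c..d})"
      using continuous_on_subset[OF v S(1)] by (intro compact_imp_bounded compact_continuous_image) auto
    then obtain M where M: "\<And>t. t \<in> {c..d} \<Longrightarrow> norm (v t) \<le> M"
      unfolding bounded_iff by blast
    have M0: "0 \<le> M" using norm_ge_zero[of "v x\<^sub>0"] M[of x\<^sub>0] S by (auto simp del: norm_ge_zero)
    let ?W = "exp (2 * oint k c d)"
    show ?thesis
      unfolding s_def u_def
    proof (rule Weierstrass_m_test)
      show "norm (picard v n x) \<le> M * (1/2) ^ n * ?W" if "x \<in> {c..d}" for n x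
        using picard_le[OF v S M that, of n] weight_le[OF S that] M0
          mult_left_mono[of "weight x" ?W "M * (1/2) ^ n"] by simp
      show "summable (\<lambda>n. M * (1/2) ^ n * ?W)"
        by (intro summable_mult summable_mult2 summable_geometric) auto
    qed
  qed
  have cont_s: "continuous_on I (s n)" for n
    unfolding s_def by (intro continuous_on_sum continuous_picard v)
  have cont_u: "continuous_on I u"
  proof (rule continuous_at_imp_continuous_on, rule ballI)
    fix x assume "x \<in> I"
    then obtain c d where cd: "{c..d} \<subseteq> I" "c \<le> x\<^sub>0" "x\<^sub>0 \<le> d" "c < x" "x < d"
      by (rule enclosing_segment)
    have "continuous_on {c..d} u"
      by (rule uniform_limit_theorem[OF _ unif[OF cd(1-3)]])
        (auto intro!: always_eventually continuous_on_subset[OF cont_s cd(1)])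
    then show "isCont u x" by (rule continuous_on_interior) (use cd in auto)
  qed
  have step: "s (Suc n) x = v x + oint (\<lambda>t. A t (s n t)) x\<^sub>0 x" if "x \<in> I" for n x
  proof (induction n)
    case 0
    have "oint (\<lambda>t. A t 0) x\<^sub>0 x = oint (\<lambda>t. 0) x\<^sub>0 x"
    proof (rule oint_cong)
      fix t assume "min x\<^sub>0 x \<le> t" "t \<le> max x\<^sub>0 x"
      then have "t \<in> I"
        by (rule between_mem[OF that])
      then show "A t 0 = 0" by (rule linear_0[OF A_linear])
    qed
    then show ?case by (simp add: s_def oint_const)
  next
    case (Suc n)
    have "oint (\<lambda>t. A t (s (Suc n) t)) x\<^sub>0 x = oint (\<lambda>t. A t (s n t) + A t (picard v n t)) x\<^sub>0 x"
    proof (rule oint_cong)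
      fix t assume "min x\<^sub>0 x \<le> t" "t \<le> max x\<^sub>0 x"
      then have "t \<in> I"
        by (rule between_mem[OF that])
      then show "A t (s (Suc n) t) = A t (s n t) + A t (picard v n t)"
        by (simp add: s_def linear_add[OF A_linear])
    qed
    also have "\<dots> = oint (\<lambda>t. A t (s n t)) x\<^sub>0 x + picard v (Suc n) x"
      using oint_add[OF interval A_comp_L1loc[OF cont_s] A_comp_L1loc[OF continuous_picard[OF v]] x0 that]
      by simp
    finally show ?case using Suc.IH by (simp add: s_def)
  qed
  have "u x = v x + oint (\<lambda>t. A t (u t)) x\<^sub>0 x" if x: "x \<in> I" for x
  proof -
    obtain c d where cd: "{c..d} \<subseteq> I" "c \<le> x\<^sub>0" "x\<^sub>0 \<le> d" "c < x" "x < d"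
      using x by (rule enclosing_segment)
    then have xS: "x \<in> {c..d}" by auto
    have "(\<lambda>n. oint (\<lambda>t. A t (s n t)) x\<^sub>0 x) \<longlonglongrightarrow> oint (\<lambda>t. A t (u t)) x\<^sub>0 x"
    proof (rule LIMSEQ_I)
      fix r :: real assume r: "r > 0"
      \<comment> \<open>Uniform closeness \<open>e\<close> of \<open>s n\<close> and \<open>u\<close> makes the integrals closer than \<open>e * weight x = r\<close>.\<close>
      define e where "e = r / weight x"
      have e: "e > 0" using r weight_ge_1[of x] by (simp add: e_def)
      obtain N where N: "\<And>n t. n \<ge> N \<Longrightarrow> t \<in> {c..d} \<Longrightarrow> dist (s n t) (u t) < e"
        using uniform_limitD[OF unif[OF cd(1-3)] e] unfolding eventually_sequentially by blast
      have "norm (oint (\<lambda>t. A t (s n t)) x\<^sub>0 x - oint (\<lambda>t. A t (u t)) x\<^sub>0 x) < r" if "n \<ge> N" for n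
      proof -
        have "oint (\<lambda>t. A t (s n t)) x\<^sub>0 x - oint (\<lambda>t. A t (u t)) x\<^sub>0 x = oint (\<lambda>t. A t (s n t - u t)) x\<^sub>0 x"
        proof -
          have "oint (\<lambda>t. A t (s n t - u t)) x\<^sub>0 x = oint (\<lambda>t. A t (s n t) - A t (u t)) x\<^sub>0 x"
          proof (rule oint_cong)
            fix t assume "min x\<^sub>0 x \<le> t" "t \<le> max x\<^sub>0 x"
            then have "t \<in> I" using segment_subset[OF cd(2,3) xS] cd(1) by blast
            then show "A t (s n t - u t) = A t (s n t) - A t (u t)" by (rule linear_diff[OF A_linear])
          qed
          then show ?thesis
            using oint_diff[OF interval A_comp_L1loc[OF cont_s] A_comp_L1loc[OF cont_u] x0 x] by simp
        qed
        also have "norm \<dots> \<le> e * ((weight x - 1) / 2)"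
        proof (rule oint_A_le)
          show "continuous_on I (\<lambda>t. s n t - u t)" by (intro continuous_intros cont_s cont_u)
          fix t assume "min x\<^sub>0 x \<le> t" "t \<le> max x\<^sub>0 x"
          then have "t \<in> {c..d}" by (rule segment_subset[OF cd(2,3) xS])
          then have "norm (s n t - u t) \<le> e" using N[OF that, of t] by (simp add: dist_norm)
          also have "e \<le> e * weight t" using mult_left_mono[OF weight_ge_1, of e t] e by simp
          finally show "norm (s n t - u t) \<le> e * weight t" .
        qed (use x e in auto)
        also have "\<dots> < e * weight x" using e weight_ge_1[of x] by (intro mult_strict_left_mono) auto
        also have "\<dots> = r" using weight_ge_1[of x] by (simp add: e_def)
        finally show ?thesis .
      qed
      then show "\<exists>N. \<forall>n\<ge>N. norm (oint (\<lambda>t. A t (s n t)) x\<^sub>0 x - oint (\<lambda>t. A t (u t)) x\<^sub>0 x) < r" by blast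
    qed
    then have "(\<lambda>n. s (Suc n) x) \<longlonglongrightarrow> v x + oint (\<lambda>t. A t (u t)) x\<^sub>0 x"
      unfolding step[OF x] by (intro tendsto_intros)
    moreover have "(\<lambda>n. s (Suc n) x) \<longlonglongrightarrow> u x"
      by (rule LIMSEQ_Suc) (rule tendsto_uniform_limitI[OF unif[OF cd(1-3)] xS])
    ultimately show ?thesis using LIMSEQ_unique by blast
  qed
  then show ?thesis using cont_u unfolding solves_def by blast
qed

end

section \<open>Lebesgue's differentiation theorem\<close>

text \<open>By Henstock's lemma, the errors \<open>\<bar>content J * f x - \<integral>\<^sub>J f\<bar>\<close> over a sufficiently fine family of
  disjoint intervals \<open>J\<close> with tags \<open>x\<close> have a small sum. Each point of the set below is the end
  point of arbitrarily short intervals on which the error exceeds \<open>e\<close> times the length. Vitali's theorem extracts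
  disjoint ones that cover the set up to a null set, and their total length must be small.\<close>

lemma Henstock_differentiation_set_negligible:
  fixes f :: "real \<Rightarrow> real"
  assumes f: "f integrable_on {a..b}" and e: "e > 0"
  shows "negligible {x \<in> {a<..<b}. \<forall>d>0. \<exists>y\<in>{a..b}. \<bar>y - x\<bar> < d \<and>
    \<bar>\<bar>y - x\<bar> * f x - integral {min x y..max x y} f\<bar> > e * \<bar>y - x\<bar>}" (is "negligible ?S")
  unfolding negligible_outer_le
proof (intro allI impI)
  fix \<epsilon> :: real assume \<epsilon>: "\<epsilon> > 0"
  have "e * \<epsilon> > 0" using e \<epsilon> by simp
  then obtain \<gamma> where \<gamma>: "gauge \<gamma>"
    and small: "\<And>p. p tagged_partial_division_of (cbox a b) \<Longrightarrow> \<gamma> fine p \<Longrightarrow>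
      (\<Sum>(x,K)\<in>p. norm (measure lborel K *\<^sub>R f x - integral K f)) < e * \<epsilon>"
    using Henstock_lemma[of f a b "e * \<epsilon>"] f unfolding cbox_interval by blast
  \<comment> \<open>Each interval is written as a ball around its midpoint, the form in which Vitali's theorem is stated.\<close>
  define J where "J = (\<lambda>(x::real, y::real). {min x y..max x y})"
  define mid where "mid = (\<lambda>(x::real, y::real). (x + y) / 2)"
  define rad where "rad = (\<lambda>(x::real, y::real). \<bar>y - x\<bar> / 2)"
  have J_cball: "cball (mid i) (rad i) = J i" for i
    by (cases i) (auto simp: mid_def rad_def J_def cball_eq_atLeastAtMost field_simps min_def max_def)
  define K where "K = {(x, y). x \<in> ?S \<and> y \<in> {a..b} \<and> J (x, y) \<subseteq> \<gamma> x \<and>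
    \<bar>\<bar>y - x\<bar> * f x - integral (J (x, y)) f\<bar> > e * \<bar>y - x\<bar>}"
  have rad_pos: "0 < rad i" if "i \<in> K" for i
  proof -
    obtain x y where i: "i = (x, y)" by (cases i)
    have "x \<noteq> y" using that by (auto simp: i K_def J_def)
    then show ?thesis by (simp add: i rad_def)
  qed
  have fine_cover: "\<exists>i. i \<in> K \<and> x \<in> cball (mid i) (rad i) \<and> rad i < d" if x: "x \<in> ?S" and d: "d > 0" for x d
  proof -
    have "open (\<gamma> x)" "x \<in> \<gamma> x" using \<gamma> by (auto simp: gauge_def)
    then obtain r where r: "r > 0" "ball x r \<subseteq> \<gamma> x" by (meson openE)
    obtain y where y: "y \<in> {a..b}" "\<bar>y - x\<bar> < min d r"
      "\<bar>\<bar>y - x\<bar> * f x - integral {min x y..max x y} f\<bar> > e * \<bar>y - x\<bar>"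
    proof -
      have "\<forall>d>0. \<exists>y\<in>{a..b}. \<bar>y - x\<bar> < d \<and>
          \<bar>\<bar>y - x\<bar> * f x - integral {min x y..max x y} f\<bar> > e * \<bar>y - x\<bar>"
        using x by simp
      moreover have "min d r > 0" using d r(1) by simp
      ultimately show thesis using that by blast
    qed
    have "J (x, y) \<subseteq> ball x r" using y(2) by (auto simp: J_def dist_real_def)
    then have "(x, y) \<in> K" using x y r(2) by (auto simp: K_def J_def)
    moreover have "x \<in> cball (mid (x, y)) (rad (x, y))" by (simp add: J_cball J_def)
    moreover have "rad (x, y) < d" using y(2) by (auto simp: rad_def)
    ultimately show ?thesis by blast
  qed
  obtain C where C: "countable C" "C \<subseteq> K"
    "pairwise (\<lambda>i j. disjnt (cball (mid i) (rad i)) (cball (mid j) (rad j))) C"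
    "negligible (?S - (\<Union>i\<in>C. cball (mid i) (rad i)))"
    using Vitali_covering_theorem_cballs[of K rad ?S mid] rad_pos fine_cover by blast
  have disj: "J i \<inter> J j = {}" if "i \<in> C" "j \<in> C" "i \<noteq> j" for i j
    using C(3) that by (auto simp: pairwise_def disjnt_def J_cball)
  have bound: "measure lebesgue (\<Union>i\<in>F. J i) \<le> \<epsilon>" if F: "F \<subseteq> C" "finite F" for F
  proof -
    define p where "p = (\<lambda>i. (fst i, J i)) ` F"
    have inK: "i \<in> K" if "i \<in> F" for i using that F C by auto
    have mem: "fst i \<in> J i" for i by (cases i) (auto simp: J_def)
    have inj: "inj_on (\<lambda>i. (fst i, J i)) F"
    proof (rule inj_onI)
      fix i j assume ij: "i \<in> F" "j \<in> F" "(fst i, J i) = (fst j, J j)"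
      then have "J i \<inter> J j \<noteq> {}" using mem[of i] by auto
      then show "i = j" using disj[of i j] ij(1,2) F(1) by blast
    qed
    have "p tagged_partial_division_of (cbox a b)"
      unfolding tagged_partial_division_of_def
    proof (intro conjI allI impI)
      show "finite p" using F by (simp add: p_def)
      fix x L assume "(x, L) \<in> p"
      then obtain i where i: "i \<in> F" "x = fst i" "L = J i" by (auto simp: p_def)
      obtain x' y where xy: "i = (x', y)" by (cases i)
      show "x \<in> L" using i mem by simp
      show "L \<subseteq> cbox a b" using inK[OF i(1)] by (auto simp: i(3) xy J_def K_def)
      show "\<exists>a b. L = cbox a b" 
        unfolding i(3) xy J_def
        by (intro exI[of _ "min x' y"] exI[of _ "max x' y"]) simp
    next
      fix x1 L1 x2 L2 assume "(x1, L1) \<in> p \<and> (x2, L2) \<in> p \<and> (x1, L1) \<noteq> (x2, L2)"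
      then obtain i j where ij: "i \<in> F" "j \<in> F" "L1 = J i" "L2 = J j" "i \<noteq> j"
        unfolding p_def by blast
      then have "L1 \<inter> L2 = {}" using disj[of i j] F(1) by blast
      then show "interior L1 \<inter> interior L2 = {}"
        using interior_subset[of L1] interior_subset[of L2] by blast
    qed
    moreover have "\<gamma> fine p"
    proof (rule fineI)
      fix x L assume "(x, L) \<in> p"
      then obtain i where i: "i \<in> F" "x = fst i" "L = J i" by (auto simp: p_def)
      obtain x' y where xy: "i = (x', y)" by (cases i)
      show "L \<subseteq> \<gamma> x" using inK[OF i(1)] by (simp add: i xy K_def)
    qed
    ultimately have "(\<Sum>(x,K)\<in>p. norm (measure lborel K *\<^sub>R f x - integral K f)) < e * \<epsilon>" by (rule small)
    then have sum_less: "(\<Sum>i\<in>F. norm (measure lborel (J i) *\<^sub>R f (fst i) - integral (J i) f)) < e * \<epsilon>"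
      unfolding p_def by (simp add: sum.reindex[OF inj])
    have len: "measure lborel (J i) = 2 * rad i" for i
      by (cases i) (auto simp: J_def rad_def min_def max_def)
    have "e * (\<Sum>i\<in>F. measure lborel (J i)) \<le> (\<Sum>i\<in>F. norm (measure lborel (J i) *\<^sub>R f (fst i) - integral (J i) f))"
      unfolding sum_distrib_left
    proof (rule sum_mono)
      fix i assume "i \<in> F"
      obtain x y where i: "i = (x, y)" by (cases i)
      show "e * measure lborel (J i) \<le> norm (measure lborel (J i) *\<^sub>R f (fst i) - integral (J i) f)"
        using inK[OF \<open>i \<in> F\<close>] unfolding i len by (simp add: K_def rad_def)
    qed
    with sum_less have "e * (\<Sum>i\<in>F. measure lborel (J i)) < e * \<epsilon>" by simp
    then have "(\<Sum>i\<in>F. measure lborel (J i)) \<le> \<epsilon>" using e by simp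
    moreover have "measure lebesgue (\<Union>i\<in>F. J i) \<le> (\<Sum>i\<in>F. measure lebesgue (J i))"
      using F(2) by (intro measure_UNION_le) (auto simp flip: J_cball)
    moreover have "measure lebesgue (J i) = measure lborel (J i)" for i
      by (cases i) (simp add: J_def measure_completion)
    ultimately show ?thesis by simp
  qed
  have lm: "J i \<in> lmeasurable" for i by (simp flip: J_cball)
  let ?N = "?S - (\<Union>i\<in>C. J i)"
  have N: "?N \<in> lmeasurable" "measure lebesgue ?N = 0"
    using C(4) by (simp_all add: J_cball negligible_imp_measurable negligible_imp_measure0)
  have U: "(\<Union>i\<in>C. J i) \<in> lmeasurable" "measure lebesgue (\<Union>i\<in>C. J i) \<le> \<epsilon>"
    using fmeasurable_UN_bound[OF C(1) lm bound] measure_UN_bound[OF C(1) lm bound] by auto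
  show "\<exists>T. ?S \<subseteq> T \<and> T \<in> lmeasurable \<and> measure lebesgue T \<le> \<epsilon>"
  proof (intro exI conjI)
    show "?S \<subseteq> ?N \<union> (\<Union>i\<in>C. J i)" by blast
    show "?N \<union> (\<Union>i\<in>C. J i) \<in> lmeasurable" using N U by (intro fmeasurable.Un)
    show "measure lebesgue (?N \<union> (\<Union>i\<in>C. J i)) \<le> \<epsilon>"
      using measure_Un_le[OF fmeasurableD[OF N(1)] fmeasurableD[OF U(1)]] N(2) U(2) by linarith
  qed
qed

context
  fixes I :: "real set"
  assumes I: "is_interval I" and openI: "open I"
begin

lemma oint_has_vector_derivative_iff:
  fixes f :: "real \<Rightarrow> 'b::{banach, second_countable_topology}"
  assumes f: "f \<in> L1loc I" and x: "x\<^sub>0 \<in> I" "x \<in> I"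
  shows "(oint f x\<^sub>0 has_vector_derivative D) (at x) \<longleftrightarrow>
    (\<forall>e>0. \<forall>\<^sub>F y in at x. norm (oint f x y - (y - x) *\<^sub>R D) \<le> e * \<bar>y - x\<bar>)"
proof -
  have near: "\<forall>\<^sub>F y in at x. y \<in> I"
    using openI x(2) by (auto simp: eventually_at_topological)
  have "(norm (oint f x\<^sub>0 y - oint f x\<^sub>0 x - (y - x) *\<^sub>R D) \<le> e * \<bar>y - x\<bar>) \<longleftrightarrow>
      (norm (oint f x y - (y - x) *\<^sub>R D) \<le> e * \<bar>y - x\<bar>)" if "y \<in> I" for y e
    by (simp flip: oint_combine[OF I f x that])
  then have "(\<forall>\<^sub>F y in at x. norm (oint f x\<^sub>0 y - oint f x\<^sub>0 x - (y - x) *\<^sub>R D) \<le> e * \<bar>y - x\<bar>) \<longleftrightarrow>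
      (\<forall>\<^sub>F y in at x. norm (oint f x y - (y - x) *\<^sub>R D) \<le> e * \<bar>y - x\<bar>)" for e
    by (intro eventually_subst) (use near in \<open>auto elim: eventually_mono\<close>)
  then show ?thesis
    by (simp add: has_vector_derivative_def has_derivative_within_alt2 bounded_linear_scaleR_left)
qed

lemma oint_has_vector_derivative_continuous:
  fixes f :: "real \<Rightarrow> 'b::{banach, second_countable_topology}"
  assumes f: "continuous_on I f" and x: "x\<^sub>0 \<in> I" "x \<in> I"
  shows "(oint f x\<^sub>0 has_vector_derivative f x) (at x)"
  unfolding oint_has_vector_derivative_iff[OF L1loc_continuous[OF f] x]
proof (intro allI impI)
  fix e :: real assume e: "e > 0"
  have "isCont f x" using f openI x(2) continuous_on_eq_continuous_at by blast
  then obtain r where r: "r > 0" "\<And>t. dist t x < r \<Longrightarrow> dist (f t) (f x) < e"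
    using e unfolding continuous_at_eps_delta by blast
  have "\<forall>\<^sub>F y in at x. y \<in> I \<inter> ball x r"
    by (rule eventually_at_in_open') (use openI x r in auto)
  then show "\<forall>\<^sub>F y in at x. norm (oint f x y - (y - x) *\<^sub>R f x) \<le> e * \<bar>y - x\<bar>"
  proof eventually_elim
    case (elim y)
    have "oint f x y - (y - x) *\<^sub>R f x = oint (\<lambda>t. f t - f x) x y"
      using oint_diff[OF I L1loc_continuous[OF f] L1loc_continuous[OF continuous_on_const] x(2), of y "f x"] elim
      by (simp add: oint_const)
    also have "norm \<dots> \<le> \<bar>oint (\<lambda>_. e) x y\<bar>"
    proof (rule oint_norm_le[OF I])
      show "(\<lambda>t. f t - f x) \<in> L1loc I"
        by (intro L1loc_continuous continuous_intros f)
      fix t assume "min x y \<le> t" "t \<le> max x y"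
      then have "dist t x < r" using elim by (auto simp: dist_real_def min_def max_def split: if_splits)
      then show "norm (f t - f x) \<le> e" using r(2) by (simp add: dist_norm less_imp_le)
    qed (use x elim in \<open>auto intro: L1loc_continuous\<close>)
    also have "\<dots> = e * \<bar>y - x\<bar>" using e by (simp add: oint_const abs_mult)
    finally show ?case .
  qed
qed

lemma rational_subinterval:
  assumes "x \<in> I"
  obtains q r where "q \<in> \<rat>" "r \<in> \<rat>" "q < x" "x < r" "{q..r} \<subseteq> I"
proof -
  obtain e where e: "e > 0" "cball x e \<subseteq> I" using openI assms by (meson open_contains_cball)
  obtain q where q: "q \<in> \<rat>" "x - e < q" "q < x" using Rats_dense_in_real[of "x - e" x] e(1) by auto
  obtain r where r: "r \<in> \<rat>" "x < r" "r < x + e" using Rats_dense_in_real[of x "x + e"] e(1) by auto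
  have "{q..r} \<subseteq> cball x e" using q r by (auto simp: dist_real_def)
  then show thesis using that q r e(2) by blast
qed

text \<open>The exceptional sets are indexed by compact intervals with rational end points and by
  tolerances \<open>1/(n+1)\<close>, so only countably many are collected.\<close>

lemma Lebesgue_differentiation_real:
  fixes f :: "real \<Rightarrow> real"
  assumes f: "f \<in> L1loc I" and x0: "x\<^sub>0 \<in> I"
  shows "\<exists>N. negligible N \<and> (\<forall>x\<in>I - N. (oint f x\<^sub>0 has_vector_derivative f x) (at x))"
proof -
  define bad where "bad = (\<lambda>a b e x. \<forall>d>0. \<exists>y\<in>{a..b}. \<bar>y - x\<bar> < d \<and>
    \<bar>\<bar>y - x\<bar> * f x - integral {min x y..max x y} f\<bar> > e * \<bar>y - x\<bar>)"
  define S where "S = (\<lambda>a b e. {x \<in> {a<..<b}. bad a b e x})"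
  define N where "N = (\<Union>(q, r, n) \<in> {(q, r, n::nat). q \<in> \<rat> \<and> r \<in> \<rat> \<and> {q..r} \<subseteq> I}. S q r (1 / real (Suc n)))"
  have "negligible N"
    unfolding N_def
  proof (rule negligible_countable_Union, safe)
    have "{(q, r, n::nat). q \<in> \<rat> \<and> r \<in> \<rat> \<and> {q..r} \<subseteq> I} \<subseteq> \<rat> \<times> (\<rat> \<times> UNIV)" by auto
    then have "countable {(q, r, n::nat). q \<in> \<rat> \<and> r \<in> \<rat> \<and> {q..r} \<subseteq> I}"
      by (rule countable_subset) (intro countable_SIGMA countable_rat countableI_type)
    then show "countable ((\<lambda>(q, r, n). S q r (1 / real (Suc n))) `
        {(q, r, n::nat). q \<in> \<rat> \<and> r \<in> \<rat> \<and> {q..r} \<subseteq> I})" by simp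
    fix q r :: real and n :: nat assume "{q..r} \<subseteq> I"
    then have "f integrable_on {q..r}"
      using L1loc_integrable[OF f] set_lebesgue_integral_eq_integral(1) by blast
    then show "negligible (S q r (1 / real (Suc n)))"
      unfolding S_def bad_def by (rule Henstock_differentiation_set_negligible) simp
  qed
  moreover have "(oint f x\<^sub>0 has_vector_derivative f x) (at x)" if x: "x \<in> I" "x \<notin> N" for x
    unfolding oint_has_vector_derivative_iff[OF f x0 x(1)]
  proof (intro allI impI)
    fix e :: real assume "e > 0"
    then obtain n where n: "1 / real (Suc n) < e" using nat_approx_posE by metis
    obtain q r where qr: "q \<in> \<rat>" "r \<in> \<rat>" "q < x" "x < r" "{q..r} \<subseteq> I"
      using rational_subinterval[OF x(1)] by metis
    have "x \<notin> S q r (1 / real (Suc n))" using x(2) qr unfolding N_def by blast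
    then have "\<not> bad q r (1 / real (Suc n)) x" using qr by (auto simp: S_def)
    then obtain d where "d > 0" and "\<not> (\<exists>y\<in>{q..r}. \<bar>y - x\<bar> < d \<and>
        \<bar>\<bar>y - x\<bar> * f x - integral {min x y..max x y} f\<bar> > 1 / real (Suc n) * \<bar>y - x\<bar>)"
      unfolding bad_def by blast
    then have d: "d > 0" "\<And>y. y \<in> {q..r} \<Longrightarrow> \<bar>y - x\<bar> < d \<Longrightarrow>
        \<bar>\<bar>y - x\<bar> * f x - integral {min x y..max x y} f\<bar> \<le> 1 / real (Suc n) * \<bar>y - x\<bar>"
      using not_le_imp_less by blast+
    have "norm (oint f x y - (y - x) *\<^sub>R f x) \<le> e * \<bar>y - x\<bar>"
      if y: "y \<in> {q..r}" "\<bar>y - x\<bar> < d" for y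
    proof -
      have si: "set_integrable lebesgue {min x y..max x y} f"
        using y(1) qr by (intro L1loc_integrable[OF f] order_trans[OF _ qr(5)]) (auto simp: min_def max_def)
      then have int: "integral {min x y..max x y} f = oint f (min x y) (max x y)"
        using oint_eq_set_integral[of "min x y" "max x y" f] set_lebesgue_integral_eq_integral(2)[OF si]
        by simp
      have "\<bar>oint f x y - (y - x) * f x\<bar> = \<bar>\<bar>y - x\<bar> * f x - integral {min x y..max x y} f\<bar>"
      proof (cases "x \<le> y")
        case True
        then show ?thesis unfolding int by (simp add: min_def max_def abs_minus_commute)
      next
        case False
        then show ?thesis unfolding int by (simp add: min_def max_def oint_swap[of y x] algebra_simps)
      qed
      also have "\<dots> \<le> 1 / real (Suc n) * \<bar>y - x\<bar>" using d(2) y by blast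
      also have "\<dots> \<le> e * \<bar>y - x\<bar>" using n by (intro mult_right_mono) auto
      finally show ?thesis by simp
    qed
    moreover have "\<forall>\<^sub>F y in at x. y \<in> {q<..<r} \<inter> ball x d"
      by (rule eventually_at_in_open') (use qr d in auto)
    ultimately show "\<forall>\<^sub>F y in at x. norm (oint f x y - (y - x) *\<^sub>R f x) \<le> e * \<bar>y - x\<bar>"
      by (auto elim!: eventually_mono simp: dist_real_def abs_minus_commute)
  qed
  ultimately show ?thesis by blast
qed

text \<open>Reduction to real functions: apply the scalar theorem to \<open>\<parallel>f - d\<parallel>\<close> for every \<open>d\<close> in a countable
  dense set. At a common point of differentiability, choose \<open>d\<close> close to \<open>f x\<close>; the mean of
  \<open>\<parallel>f - f x\<parallel>\<close> near \<open>x\<close> is then at most about \<open>2 \<parallel>f x - d\<parallel>\<close>.\<close>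

lemma Lebesgue_differentiation:
  fixes f :: "real \<Rightarrow> 'b::{banach, second_countable_topology}"
  assumes f: "f \<in> L1loc I" and x0: "x\<^sub>0 \<in> I"
  shows "\<exists>N. negligible N \<and> (\<forall>x\<in>I - N. (oint f x\<^sub>0 has_vector_derivative f x) (at x))"
proof -
  obtain D :: "'b set" where D: "countable D" "\<And>X. open X \<Longrightarrow> X \<noteq> {} \<Longrightarrow> \<exists>d\<in>D. d \<in> X"
    by (erule countable_dense_setE)
  have L1: "(\<lambda>t. f t - v) \<in> L1loc I" for v
    using L1loc_diff[OF f L1loc_continuous[OF continuous_on_const]] .
  note k = L1loc_norm[OF L1]
  obtain N where N: "\<And>d. negligible (N d)"
    "\<And>d x. x \<in> I - N d \<Longrightarrow> (oint (\<lambda>t. norm (f t - d)) x\<^sub>0 has_vector_derivative norm (f x - d)) (at x)"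
    using Lebesgue_differentiation_real[OF k x0] by metis
  have "negligible (\<Union>d\<in>D. N d)"
    using N(1) D(1) by (intro negligible_countable_Union) auto
  moreover have "(oint f x\<^sub>0 has_vector_derivative f x) (at x)" if x: "x \<in> I" "x \<notin> (\<Union>d\<in>D. N d)" for x
    unfolding oint_has_vector_derivative_iff[OF f x0 x(1)]
  proof (intro allI impI)
    fix e :: real assume e: "e > 0"
    obtain d where d: "d \<in> D" "d \<in> ball (f x) (e/4)" using D(2)[of "ball (f x) (e/4)"] e by auto
    then have close: "norm (f x - d) < e/4" by (simp add: dist_norm)
    have "(oint (\<lambda>t. norm (f t - d)) x\<^sub>0 has_vector_derivative norm (f x - d)) (at x)"
      using N(2) x d(1) by blast
    then have "\<forall>\<^sub>F y in at x. norm (oint (\<lambda>t. norm (f t - d)) x y - (y - x) *\<^sub>R norm (f x - d)) \<le> e/4 * \<bar>y - x\<bar>"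
      unfolding oint_has_vector_derivative_iff[OF k x0 x(1)] using e by (meson zero_less_divide_iff zero_less_numeral)
    moreover have "\<forall>\<^sub>F y in at x. y \<in> I"
      using openI x(1) by (auto simp: eventually_at_topological)
    ultimately show "\<forall>\<^sub>F y in at x. norm (oint f x y - (y - x) *\<^sub>R f x) \<le> e * \<bar>y - x\<bar>"
    proof eventually_elim
      case (elim y)
      let ?k = "oint (\<lambda>t. norm (f t - d)) x y"
      have "\<bar>(y - x) * norm (f x - d)\<bar> \<le> e/4 * \<bar>y - x\<bar>"
        unfolding abs_mult using close by (subst mult.commute) (intro mult_right_mono, auto)
      with elim(1) have k_le: "\<bar>?k\<bar> \<le> e/2 * \<bar>y - x\<bar>"
        unfolding real_norm_def real_scaleR_def by linarith
      have c: "\<bar>oint (\<lambda>_. norm (d - f x)) x y\<bar> \<le> e/4 * \<bar>y - x\<bar>"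
        using mult_left_mono[of "norm (d - f x)" "e/4" "\<bar>y - x\<bar>"] close
        by (simp add: oint_const abs_mult norm_minus_commute mult.commute)
      have "oint f x y - (y - x) *\<^sub>R f x = oint (\<lambda>t. f t - f x) x y"
        using oint_diff[OF I f L1loc_continuous[OF continuous_on_const] x(1) elim(2)] by (simp add: oint_const)
      also have "norm \<dots> \<le> \<bar>oint (\<lambda>t. norm (f t - d) + norm (d - f x)) x y\<bar>"
        by (rule oint_norm_le[OF I L1 L1loc_add[OF k L1loc_continuous[OF continuous_on_const]] x(1) elim(2)])
          (metis norm_triangle_ineq diff_add_cancel add_diff_eq)
      also have "\<dots> = \<bar>?k + oint (\<lambda>_. norm (d - f x)) x y\<bar>"
        using oint_add[OF I k L1loc_continuous[OF continuous_on_const] x(1) elim(2)] by simp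
      also have "\<dots> \<le> e/2 * \<bar>y - x\<bar> + e/4 * \<bar>y - x\<bar>" using k_le c by linarith
      also have "\<dots> \<le> e * \<bar>y - x\<bar>" using e by (simp add: field_simps)
      finally show ?case .
    qed
  qed
  ultimately show ?thesis by blast
qed

end

context linear_integral_equation
begin

text \<open>The null set depends neither on \<open>u\<close> nor on a vector. It collects the exceptional sets of \<open>k\<close> and
  of \<open>A \<cdot> d\<close> for \<open>d\<close> in a countable dense set. Elsewhere choose \<open>d\<close> close to \<open>u x\<close>: replacing
  \<open>u\<close> by \<open>d\<close> costs at most a small multiple of \<open>\<integral> k\<close>, and \<open>\<integral> k\<close> grows at most linearly near \<open>x\<close>.\<close>

lemma oint_A_has_vector_derivative_ae:
  "\<exists>N. negligible N \<and> (\<forall>x\<in>I - N. \<forall>u. continuous_on I u \<longrightarrow>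
    (oint (\<lambda>t. A t (u t)) x\<^sub>0 has_vector_derivative A x (u x)) (at x))"
proof -
  obtain D :: "'x set" where D: "countable D" "\<And>X. open X \<Longrightarrow> X \<noteq> {} \<Longrightarrow> \<exists>d\<in>D. d \<in> X"
    by (erule countable_dense_setE)
  have L1: "(\<lambda>t. A t d) \<in> L1loc I" for d
    using A_comp_L1loc[of "\<lambda>_. d"] by simp
  obtain N where N: "\<And>d. negligible (N d)"
    "\<And>d x. x \<in> I - N d \<Longrightarrow> (oint (\<lambda>t. A t d) x\<^sub>0 has_vector_derivative A x d) (at x)"
    using Lebesgue_differentiation[OF interval openI L1 x0] by metis
  obtain N' where N': "negligible N'" "\<And>x. x \<in> I - N' \<Longrightarrow> (oint k x\<^sub>0 has_vector_derivative k x) (at x)"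
    using Lebesgue_differentiation[OF interval openI k_L1 x0] by metis
  have "negligible (N' \<union> (\<Union>d\<in>D. N d))"
    using N(1) D(1) N'(1) by (intro negligible_Un negligible_countable_Union) auto
  moreover have "(oint (\<lambda>t. A t (u t)) x\<^sub>0 has_vector_derivative A x (u x)) (at x)"
    if x: "x \<in> I" "x \<notin> N' \<union> (\<Union>d\<in>D. N d)" and u: "continuous_on I u" for x u
    unfolding oint_has_vector_derivative_iff[OF interval openI A_comp_L1loc[OF u] x0 x(1)]
  proof (intro allI impI)
    fix e :: real assume e: "e > 0"
    note kx = k_nonneg[OF x(1)]
    \<comment> \<open>The three errors below add up to \<open>\<eta> * (2 * k x + 2) * \<bar>y - x\<bar>\<close>.\<close>
    define \<eta> where "\<eta> = e / (2 * k x + 2)"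
    have \<eta>: "\<eta> > 0" using e kx by (simp add: \<eta>_def)
    obtain d where d: "d \<in> D" "d \<in> ball (u x) (\<eta>/2)" using D(2)[of "ball (u x) (\<eta>/2)"] \<eta> by auto
    then have close: "norm (u x - d) < \<eta>/2" by (simp add: dist_norm)
    have "isCont u x" using u openI x(1) continuous_on_eq_continuous_at by blast
    then obtain r where r: "r > 0" "\<And>t. dist t x < r \<Longrightarrow> dist (u t) (u x) < \<eta>/2"
      using half_gt_zero[OF \<eta>] unfolding continuous_at_eps_delta by blast
    have "(oint (\<lambda>t. A t d) x\<^sub>0 has_vector_derivative A x d) (at x)"
      using N(2) x d(1) by blast
    then have "\<forall>\<^sub>F y in at x. norm (oint (\<lambda>t. A t d) x y - (y - x) *\<^sub>R A x d) \<le> \<eta> * \<bar>y - x\<bar>"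
      unfolding oint_has_vector_derivative_iff[OF interval openI L1 x0 x(1)] using \<eta> by blast
    moreover have "(oint k x\<^sub>0 has_vector_derivative k x) (at x)"
      using N'(2) x by blast
    then have "\<forall>\<^sub>F y in at x. norm (oint k x y - (y - x) *\<^sub>R k x) \<le> 1 * \<bar>y - x\<bar>"
      unfolding oint_has_vector_derivative_iff[OF interval openI k_L1 x0 x(1)] using zero_less_one by blast
    moreover have "\<forall>\<^sub>F y in at x. y \<in> I \<inter> ball x r"
      by (rule eventually_at_in_open') (use openI x r in auto)
    ultimately show "\<forall>\<^sub>F y in at x. norm (oint (\<lambda>t. A t (u t)) x y - (y - x) *\<^sub>R A x (u x)) \<le> e * \<bar>y - x\<bar>"
    proof eventually_elim
      case (elim y)
      then have yI: "y \<in> I" and yr: "\<bar>y - x\<bar> < r" by (auto simp: dist_real_def abs_minus_commute)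
      have ud: "continuous_on I (\<lambda>t. u t - d)" by (intro continuous_intros u)
      have seg: "t \<in> I" "dist t x < r" if "min x y \<le> t" "t \<le> max x y" for t
        using that yr closed_segment_in_interval[OF interval x(1) yI] closed_segment_in_interval[OF interval yI x(1)]
        by (auto simp: min_def max_def dist_real_def split: if_splits)
      have "oint (\<lambda>t. A t (u t - d)) x y = oint (\<lambda>t. A t (u t) - A t d) x y"
        by (rule oint_cong) (simp add: linear_diff[OF A_linear] seg)
      also have "\<dots> = oint (\<lambda>t. A t (u t)) x y - oint (\<lambda>t. A t d) x y"
        by (rule oint_diff[OF interval A_comp_L1loc[OF u] L1 x(1) yI])
      finally have split: "oint (\<lambda>t. A t (u t)) x y = oint (\<lambda>t. A t (u t - d)) x y + oint (\<lambda>t. A t d) x y"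
        by simp
      have "norm (oint (\<lambda>t. A t (u t - d)) x y) \<le> \<bar>oint (\<lambda>t. \<eta> *\<^sub>R k t) x y\<bar>"
      proof (rule oint_norm_le[OF interval A_comp_L1loc[OF ud] L1loc_scaleR[OF k_L1] x(1) yI])
        fix t assume t: "min x y \<le> t" "t \<le> max x y"
        have "norm (u t - d) \<le> norm (u t - u x) + norm (u x - d)"
          using norm_triangle_ineq[of "u t - u x" "u x - d"] by simp
        also have "\<dots> \<le> \<eta>" using r(2)[OF seg(2)[OF t]] close by (simp add: dist_norm)
        finally have "k t * norm (u t - d) \<le> k t * \<eta>"
          using k_nonneg[OF seg(1)[OF t]] by (rule mult_left_mono)
        then show "norm (A t (u t - d)) \<le> \<eta> *\<^sub>R k t"
          using A_bound[OF seg(1)[OF t], of "u t - d"] by (simp add: mult.commute)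
      qed
      also have "\<dots> = \<eta> * \<bar>oint k x y\<bar>" using \<eta> by (simp add: abs_mult)
      also have "\<bar>oint k x y\<bar> \<le> \<bar>(y - x) * k x\<bar> + \<bar>y - x\<bar>" using elim(2) by simp
      also have "\<bar>(y - x) * k x\<bar> = k x * \<bar>y - x\<bar>" using kx by (simp add: abs_mult)
      finally have 1: "norm (oint (\<lambda>t. A t (u t - d)) x y) \<le> \<eta> * (k x * \<bar>y - x\<bar> + \<bar>y - x\<bar>)"
        using \<eta> by simp
      have "norm (A x (d - u x)) \<le> k x * norm (d - u x)" by (rule A_bound[OF x(1)])
      also have "\<dots> \<le> k x * \<eta>" using close \<eta> kx by (intro mult_left_mono) (auto simp: norm_minus_commute)
      finally have "norm ((y - x) *\<^sub>R A x (d - u x)) \<le> \<bar>y - x\<bar> * (k x * \<eta>)"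
        unfolding norm_scaleR by (intro mult_left_mono) auto
      then have 2: "norm ((y - x) *\<^sub>R (A x d - A x (u x))) \<le> \<bar>y - x\<bar> * (k x * \<eta>)"
        by (simp only: linear_diff[OF A_linear[OF x(1)]])
      have "oint (\<lambda>t. A t (u t)) x y - (y - x) *\<^sub>R A x (u x) =
          oint (\<lambda>t. A t (u t - d)) x y + (oint (\<lambda>t. A t d) x y - (y - x) *\<^sub>R A x d)
          + (y - x) *\<^sub>R (A x d - A x (u x))"
        unfolding split by (simp add: scaleR_diff_right)
      also have "norm \<dots> \<le> \<eta> * (k x * \<bar>y - x\<bar> + \<bar>y - x\<bar>) + \<eta> * \<bar>y - x\<bar> + \<bar>y - x\<bar> * (k x * \<eta>)"
        by (intro norm_triangle_le add_mono 1 2 elim(1))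
      also have "\<dots> = \<eta> * (2 * k x + 2) * \<bar>y - x\<bar>" by (simp add: algebra_simps)
      also have "\<dots> = e * \<bar>y - x\<bar>" using kx by (simp add: \<eta>_def)
      finally show ?case .
    qed
  qed
  ultimately show ?thesis by blast
qed

end

section \<open>Pettis' measurability theorem in a separable Hilbert space\<close>

lemma norm_diff_power2_cinner:
  fixes x y :: "'a::complex_hilbert"
  shows "(norm (x - y))\<^sup>2 = (norm x)\<^sup>2 + (norm y)\<^sup>2 - 2 * Re (cinner y x)"
proof -
  have minus: "cinner u (- v) = - cinner u v" for u v :: 'a
    using cinner_add_right[of u v "- v"] cinner_add_right[of u 0 0] by (simp add: add_eq_0_iff)
  have sub: "cinner u (v - v') = cinner u v - cinner u v'" for u v v' :: 'a
    using cinner_add_right[of u v "- v'"] by (simp add: minus)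
  have sub_left: "cinner (v - v') u = cinner v u - cinner v' u" for u v v' :: 'a
    by (metis cinner_commute complex_cnj_diff sub)
  have Re_comm: "Re (cinner x y) = Re (cinner y x)"
    by (subst cinner_commute) simp
  have nr: "(norm v)\<^sup>2 = Re (cinner v v)" for v :: 'a
    by (simp add: cinner_self)
  show ?thesis
    unfolding nr by (simp add: sub sub_left Re_comm)
qed

lemma Re_cinner_diff_right:
  fixes x y z :: "'a::complex_hilbert"
  shows "Re (cinner x (y - z)) = Re (cinner x y) - Re (cinner x z)"
  using cinner_add_right[of x "y - z" z] by simp

text \<open>Since \<open>\<parallel>y\<parallel>\<^sup>2 - \<parallel>y - d\<parallel>\<^sup>2 = 2 Re (d, y) - \<parallel>d\<parallel>\<^sup>2\<close>, the number \<open>\<parallel>y\<parallel>\<^sup>2\<close> is the supremum of the right-hand sides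
  over a dense set of \<open>d\<close>. So a ball is a countable intersection of sets given by inner products.\<close>

lemma norm_power2_le_iff_dense:
  fixes y :: "'a::complex_hilbert"
  assumes D: "\<And>X :: 'a set. open X \<Longrightarrow> X \<noteq> {} \<Longrightarrow> \<exists>d\<in>D. d \<in> X"
  shows "(norm y)\<^sup>2 \<le> R \<longleftrightarrow> (\<forall>d\<in>D. 2 * Re (cinner d y) - (norm d)\<^sup>2 \<le> R)"
proof
  assume "(norm y)\<^sup>2 \<le> R"
  then show "\<forall>d\<in>D. 2 * Re (cinner d y) - (norm d)\<^sup>2 \<le> R"
    using norm_diff_power2_cinner[of y] by (smt (verit) zero_le_power2)
next
  assume *: "\<forall>d\<in>D. 2 * Re (cinner d y) - (norm d)\<^sup>2 \<le> R"
  show "(norm y)\<^sup>2 \<le> R"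
  proof (rule field_le_epsilon)
    fix e :: real assume "e > 0"
    then obtain d where d: "d \<in> D" "d \<in> ball y (sqrt e)" using D[of "ball y (sqrt e)"] by auto
    then have "norm (y - d) \<le> sqrt e" by (simp add: dist_norm)
    then have "(norm (y - d))\<^sup>2 \<le> e"
      using power_mono[of "norm (y - d)" "sqrt e" 2] \<open>e > 0\<close> by simp
    then show "(norm y)\<^sup>2 \<le> R + e"
      using * d(1) norm_diff_power2_cinner[of y d] by fastforce
  qed
qed

text \<open>Preimages of closed balls are measurable by \<open>norm_power2_le_iff_dense\<close>, and every open set is
  a countable union of closed balls with rational radii and centres in a countable dense set.\<close>

lemma Pettis_measurable:
  fixes \<phi> :: "'t \<Rightarrow> 'a::separable_complex_hilbert"
  assumes meas: "\<And>f. (\<lambda>t. cinner f (\<phi> t)) \<in> borel_measurable M"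
  shows "\<phi> \<in> borel_measurable M"
proof (rule borel_measurableI)
  obtain D :: "'a set" where D: "countable D" "\<And>X. open X \<Longrightarrow> X \<noteq> {} \<Longrightarrow> \<exists>d\<in>D. d \<in> X"
    by (erule countable_dense_setE)
  have ball: "\<phi> -` cball c r \<inter> space M \<in> sets M" if r: "r \<ge> 0" for c r
  proof -
    have [measurable]: "(\<lambda>t. Re (cinner d (\<phi> t))) \<in> borel_measurable M" for d
      by (rule measurable_compose[OF meas borel_measurable_Re])
    have "\<phi> -` cball c r \<inter> space M =
      {t \<in> space M. \<forall>d\<in>D. 2 * (Re (cinner d (\<phi> t)) - Re (cinner d c)) - (norm d)\<^sup>2 \<le> r\<^sup>2}"
    proof -
      have "\<phi> t \<in> cball c r \<longleftrightarrow> (norm (\<phi> t - c))\<^sup>2 \<le> r\<^sup>2" for t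
        using r by (simp add: dist_norm norm_minus_commute abs_le_square_iff[symmetric])
      moreover have "(norm (\<phi> t - c))\<^sup>2 \<le> r\<^sup>2 \<longleftrightarrow>
          (\<forall>d\<in>D. 2 * (Re (cinner d (\<phi> t)) - Re (cinner d c)) - (norm d)\<^sup>2 \<le> r\<^sup>2)" for t
        by (rule norm_power2_le_iff_dense[of D "\<phi> t - c", unfolded Re_cinner_diff_right]) (rule D(2))
      ultimately have "\<phi> t \<in> cball c r \<longleftrightarrow>
          (\<forall>d\<in>D. 2 * (Re (cinner d (\<phi> t)) - Re (cinner d c)) - (norm d)\<^sup>2 \<le> r\<^sup>2)" for t
        by blast
      then show ?thesis by blast
    qed
    also have "\<dots> \<in> sets M"
      using D(1) by measurable
    finally show ?thesis .
  qed
  fix S :: "'a set" assume S: "open S"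
  define C where "C = {(d, q). d \<in> D \<and> q \<in> \<rat> \<and> 0 \<le> q \<and> cball d q \<subseteq> S}"
  have "C \<subseteq> D \<times> \<rat>" by (auto simp: C_def)
  then have "countable C"
    by (rule countable_subset) (intro countable_SIGMA countable_rat D(1))
  have "S \<subseteq> (\<Union>(d, q)\<in>C. cball d q)"
  proof
    fix x assume "x \<in> S"
    then obtain e where e: "e > 0" "ball x e \<subseteq> S" using S by (meson openE)
    obtain q where q: "q \<in> \<rat>" "e/4 < q" "q < e/2" using Rats_dense_in_real[of "e/4" "e/2"] e(1) by auto
    obtain d where d: "d \<in> D" "d \<in> ball x q" using D(2)[of "ball x q"] q e(1) by auto
    have "cball d q \<subseteq> ball x e"
    proof
      fix y assume "y \<in> cball d q"
      then show "y \<in> ball x e" using d(2) q(3) dist_triangle[of x y d] by simp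
    qed
    then have "(d, q) \<in> C" using d q e by (auto simp: C_def)
    moreover have "x \<in> cball d q" using d(2) by (simp add: dist_commute)
    ultimately show "x \<in> (\<Union>(d, q)\<in>C. cball d q)" by blast
  qed
  then have "S = (\<Union>(d, q)\<in>C. cball d q)" by (auto simp: C_def)
  then have "\<phi> -` S \<inter> space M = (\<Union>(d, q)\<in>C. \<phi> -` cball d q \<inter> space M)" by auto
  also have "\<dots> \<in> sets M"
    using \<open>countable C\<close> ball by (intro sets.countable_UN'') (auto simp: C_def)
  finally show "\<phi> -` S \<inter> space M \<in> sets M" .
qed

section \<open>The initial value problem in phase space\<close>

locale L1loc_operator =
  fixes I :: "real set" and x\<^sub>0 :: real and G :: "real \<Rightarrow> 'a::separable_complex_hilbert \<Rightarrow>\<^sub>L 'a"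
  assumes interval: "is_interval I" and openI: "open I" and x0: "x\<^sub>0 \<in> I"
    and in_BH: "\<And>t. t \<in> I \<Longrightarrow> G t \<in> BH"
    and weak_meas: "weakly_measurable_on I G"
    and norm_L1: "(\<lambda>t. norm (G t)) \<in> L1loc I"
begin

lemma strongly_measurable: "(\<lambda>t. G t h) \<in> borel_measurable (lebesgue_on I)"
  by (rule Pettis_measurable) (use weak_meas in \<open>simp add: weakly_measurable_on_def\<close>)

sublocale strong: linear_integral_equation I x\<^sub>0 "\<lambda>t. norm (G t)" "\<lambda>t. blinfun_apply (G t)"
  by unfold_locales
    (simp_all add: interval openI x0 norm_L1 strongly_measurable norm_blinfun blinfun.add_right
      blinfun.scaleR_right)

lemma apply_L1loc: "(\<lambda>t. G t h) \<in> L1loc I"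
  using strong.A_comp_L1loc[of "\<lambda>_. h"] by simp

end

lemma BH_scaleC: "T \<in> BH \<Longrightarrow> blinfun_apply T (c *\<^sub>C h) = c *\<^sub>C T h"
  by (simp add: BH_def)

lemma scaleC_1 [simp]: "1 *\<^sub>C (x :: 'a::complex_hilbert) = x"
  using scaleC_of_real[of 1 x] by simp

lemma scaleC_0_right [simp]: "c *\<^sub>C (0 :: 'a::complex_hilbert) = 0"
  using norm_scaleC[of c "0::'a"] by simp

lemma scaleC_minus_right: "c *\<^sub>C (- x) = - (c *\<^sub>C (x :: 'a::complex_hilbert))"
  using blinfun.minus_right[of "cscale c" x] by (simp add: cscale.rep_eq)

lemma scaleC_diff_right: "c *\<^sub>C (x - y) = c *\<^sub>C x - c *\<^sub>C (y :: 'a::complex_hilbert)"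
  using blinfun.diff_right[of "cscale c" x y] by (simp add: cscale.rep_eq)

lemma scaleC_diff_left: "(c - d) *\<^sub>C x = c *\<^sub>C x - d *\<^sub>C (x :: 'a::complex_hilbert)"
  using scaleC_add_left[of "c - d" d x] by simp

lemma bounded_linear_scaleC: "bounded_linear (\<lambda>x :: 'a::complex_hilbert. c *\<^sub>C x)"
  using blinfun.bounded_linear_right[of "cscale c"] by (simp add: cscale.rep_eq)

locale operator_ivp = V: L1loc_operator I x\<^sub>0 V
  for I x\<^sub>0 and V :: "real \<Rightarrow> 'a::separable_complex_hilbert \<Rightarrow>\<^sub>L 'a"
begin

text \<open>The generator of the first-order system for \<open>u = (y, y')\<close>.\<close>

definition phase :: "complex \<Rightarrow> real \<Rightarrow> 'a \<times> 'a \<Rightarrow> 'a \<times> 'a" where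
  "phase z t u = (snd u, V t (fst u) - z *\<^sub>C fst u)"

lemma norm_phase_le: "norm (phase z t u) \<le> (1 + norm (V t) + cmod z) * norm u"
proof -
  have "norm (phase z t u) \<le> norm (snd u) + norm (V t (fst u) - z *\<^sub>C fst u)"
    unfolding phase_def by (rule norm_Pair_le)
  also have "\<dots> \<le> norm (snd u) + (norm (V t) * norm (fst u) + cmod z * norm (fst u))"
    using norm_triangle_ineq4[of "V t (fst u)" "z *\<^sub>C fst u"] norm_blinfun[of "V t" "fst u"]
    by (simp add: norm_scaleC)
  also have "\<dots> \<le> norm u + (norm (V t) * norm u + cmod z * norm u)"
    using norm_fst_le[of "fst u" "snd u"] norm_snd_le[of "snd u" "fst u"]
    by (intro add_mono mult_left_mono) simp_all
  finally show ?thesis by (simp add: algebra_simps)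
qed

lemma rate_L1loc: "(\<lambda>t. 1 + norm (V t) + cmod z) \<in> L1loc I"
  by (intro L1loc_add V.norm_L1 L1loc_continuous continuous_intros)

sublocale phase: linear_integral_equation I x\<^sub>0 "\<lambda>t. 1 + norm (V t) + cmod z" "phase z" for z
proof unfold_locales
  show "norm (phase z t v) \<le> (1 + norm (V t) + cmod z) * norm v" for t v by (rule norm_phase_le)
  show "(\<lambda>t. phase z t v) \<in> borel_measurable (lebesgue_on I)" for v
    unfolding phase_def
    by (intro borel_measurable_Pair borel_measurable_diff V.strongly_measurable) auto
  show "phase z t (u + v) = phase z t u + phase z t v" for t u v
    by (simp add: phase_def blinfun.add_right scaleC_add_right)
  show "phase z t (r *\<^sub>R u) = r *\<^sub>R phase z t u" for t r u
    by (simp add: phase_def blinfun.scaleR_right scaleR_diff_right scaleR_prod_def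
        linear_cmul[OF bounded_linear.linear[OF bounded_linear_scaleC]])
qed (auto intro: V.interval V.openI V.x0 rate_L1loc)

text \<open>The inhomogeneity of the phase-space equation: the initial values together with the forcing
  term \<open>-F h\<close> integrated from \<open>x\<^sub>0\<close>.\<close>

definition data :: "(real \<Rightarrow> 'a \<Rightarrow>\<^sub>L 'a) \<Rightarrow> ('a \<Rightarrow>\<^sub>L 'a) \<Rightarrow> ('a \<Rightarrow>\<^sub>L 'a) \<Rightarrow> 'a \<Rightarrow> real \<Rightarrow> 'a \<times> 'a" where
  "data F Y\<^sub>0 Y\<^sub>1 h x = (Y\<^sub>0 h, Y\<^sub>1 h - oint (\<lambda>t. F t h) x\<^sub>0 x)"

text \<open>The initial value problem in integrated form, for an operator function and its derivative.\<close>

definition ivp_pair :: "complex \<Rightarrow> (real \<Rightarrow> 'a \<Rightarrow>\<^sub>L 'a) \<Rightarrow> ('a \<Rightarrow>\<^sub>L 'a) \<Rightarrow> ('a \<Rightarrow>\<^sub>L 'a) \<Rightarrow>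
    (real \<Rightarrow> 'a \<Rightarrow>\<^sub>L 'a) \<Rightarrow> (real \<Rightarrow> 'a \<Rightarrow>\<^sub>L 'a) \<Rightarrow> bool" where
  "ivp_pair z F Y\<^sub>0 Y\<^sub>1 Y Y' \<longleftrightarrow> (\<forall>h. phase.solves z (data F Y\<^sub>0 Y\<^sub>1 h) (\<lambda>x. (Y x h, Y' x h)))"

text \<open>The constant of the Gronwall estimate on \<open>{c..d}\<close>. It increases with \<open>cmod z\<close>, so that the estimates
  hold uniformly for bounded \<open>z\<close>.\<close>

definition growth :: "complex \<Rightarrow> real \<Rightarrow> real \<Rightarrow> real" where
  "growth z c d = 2 * exp (2 * oint (\<lambda>t. 1 + norm (V t) + cmod z) c d)"

lemma growth_pos: "0 < growth z c d"
  by (simp add: growth_def)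

lemma growth_mono:
  assumes "c \<in> I" "d \<in> I" "c \<le> d" "cmod w \<le> cmod z"
  shows "growth w c d \<le> growth z c d"
proof -
  have "oint (\<lambda>t. 1 + norm (V t) + cmod z) c d = oint (\<lambda>t. 1 + norm (V t)) c d + (d - c) * cmod z" for z
    using oint_add[OF V.interval L1loc_add[OF L1loc_continuous[OF continuous_on_const] V.norm_L1]
        L1loc_continuous[OF continuous_on_const] assms(1,2), of 1 "cmod z"]
    by (simp add: oint_const)
  then show ?thesis using assms by (simp add: growth_def mult_left_mono)
qed

lemma phase_norm_le:
  assumes "phase.solves z v u" "{c..d} \<subseteq> I" "c \<le> x\<^sub>0" "x\<^sub>0 \<le> d"
    and "\<And>t. t \<in> {c..d} \<Longrightarrow> norm (v t) \<le> M" and "x \<in> {c..d}"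
  shows "norm (u x) \<le> growth z c d * M"
proof -
  have "0 \<le> M" using norm_ge_zero[of "v x"] assms(5)[OF assms(6)] by linarith
  have "norm (u x) \<le> 2 * M * phase.weight z x"
    by (rule phase.solves_norm_le[OF assms])
  also have "\<dots> \<le> 2 * M * exp (2 * oint (\<lambda>t. 1 + norm (V t) + cmod z) c d)"
    using phase.weight_le[OF assms(2-4,6)] \<open>0 \<le> M\<close> by (intro mult_left_mono) auto
  finally show ?thesis by (simp add: growth_def mult_ac)
qed

definition scaleC2 :: "complex \<Rightarrow> 'a \<times> 'a \<Rightarrow> 'a \<times> 'a" where
  "scaleC2 c u = (c *\<^sub>C fst u, c *\<^sub>C snd u)"

lemma bounded_linear_scaleC2: "bounded_linear (scaleC2 c)"
  unfolding scaleC2_def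
  by (intro bounded_linear_Pair bounded_linear_compose[OF bounded_linear_scaleC]
      bounded_linear_fst bounded_linear_snd)

text \<open>Complex linearity of \<open>V t\<close> is used here; it makes the solution operators complex linear.\<close>

lemma phase_scaleC2: "t \<in> I \<Longrightarrow> phase z t (scaleC2 c u) = scaleC2 c (phase z t u)"
  by (simp add: phase_def scaleC2_def BH_scaleC[OF V.in_BH] scaleC_diff_right scaleC_scaleC mult.commute)

lemma solves_scaleC2:
  "phase.solves z v u \<Longrightarrow> phase.solves z (\<lambda>x. scaleC2 c (v x)) (\<lambda>x. scaleC2 c (u x))"
  by (rule phase.solves_bounded_linear[OF _ bounded_linear_scaleC2]) (auto simp: phase_scaleC2)

text \<open>A change of the spectral parameter can be moved into the inhomogeneity: \<open>-y'' + (V - w) y = f\<close> is the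
  same equation as \<open>-y'' + (V - z) y = f + (w - z) y\<close>.\<close>

lemma phase_change_parameter:
  assumes "phase.solves w v u"
  shows "phase.solves z (\<lambda>x. v x - (0, (w - z) *\<^sub>C oint (\<lambda>t. fst (u t)) x\<^sub>0 x)) u"
proof -
  have cont: "continuous_on I u" using assms by (rule phase.solves_continuous)
  have fst_L1: "(\<lambda>t. fst (u t)) \<in> L1loc I" by (intro L1loc_continuous continuous_intros cont)
  have cont': "continuous_on I (\<lambda>t. (0 :: 'a, (w - z) *\<^sub>C fst (u t)))"
    by (intro continuous_intros bounded_linear.continuous_on[OF bounded_linear_scaleC] cont)
  have T: "bounded_linear (\<lambda>y :: 'a. (0 :: 'a, (w - z) *\<^sub>C y))"
    by (intro bounded_linear_Pair bounded_linear_zero bounded_linear_scaleC)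
  have "oint (\<lambda>t. phase w t (u t)) x\<^sub>0 x =
      oint (\<lambda>t. phase z t (u t)) x\<^sub>0 x - (0, (w - z) *\<^sub>C oint (\<lambda>t. fst (u t)) x\<^sub>0 x)" if x: "x \<in> I" for x
  proof -
    have "oint (\<lambda>t. phase w t (u t)) x\<^sub>0 x = oint (\<lambda>t. phase z t (u t) - (0, (w - z) *\<^sub>C fst (u t))) x\<^sub>0 x"
      by (rule oint_cong) (simp add: phase_def scaleC_diff_left)
    then show ?thesis
      using oint_diff[OF V.interval phase.A_comp_L1loc[OF cont, of z] L1loc_continuous[OF cont'] V.x0 x]
        oint_bounded_linear[OF V.interval T fst_L1 V.x0 x] by simp
  qed
  then show ?thesis using assms by (auto simp: phase.solves_def)
qed

context
  fixes F :: "real \<Rightarrow> 'a \<Rightarrow>\<^sub>L 'a" and Y\<^sub>0 Y\<^sub>1 :: "'a \<Rightarrow>\<^sub>L 'a"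
  assumes F: "L1loc_operator I x\<^sub>0 F"
begin

interpretation F: L1loc_operator I x\<^sub>0 F by (rule F)

lemma continuous_on_data: "continuous_on I (data F Y\<^sub>0 Y\<^sub>1 h)"
  unfolding data_def
  by (intro continuous_intros continuous_on_oint[OF V.interval F.apply_L1loc V.openI V.x0])

lemma norm_data_le:
  assumes "{c..d} \<subseteq> I" "c \<le> x\<^sub>0" "x\<^sub>0 \<le> d" "x \<in> {c..d}"
  shows "norm (data F Y\<^sub>0 Y\<^sub>1 h x) \<le> (norm Y\<^sub>0 + norm Y\<^sub>1 + oint (\<lambda>t. norm (F t)) c d) * norm h"
proof -
  have mem: "c \<in> I" "d \<in> I" "x \<in> I" using assms by auto
  have hL1: "(\<lambda>t. norm h *\<^sub>R norm (F t)) \<in> L1loc I" by (rule L1loc_scaleR[OF F.norm_L1])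
  have "norm (oint (\<lambda>t. F t h) x\<^sub>0 x) \<le> \<bar>oint (\<lambda>t. norm h *\<^sub>R norm (F t)) x\<^sub>0 x\<bar>"
    by (rule oint_norm_le[OF V.interval F.apply_L1loc hL1 V.x0 mem(3)])
      (use norm_blinfun in \<open>simp add: mult.commute\<close>)
  also have "\<dots> \<le> oint (\<lambda>t. norm h *\<^sub>R norm (F t)) c d"
    by (rule oint_mono_segment[OF V.interval hL1 _ mem(1,2)]) (use assms in auto)
  finally have 1: "norm (oint (\<lambda>t. F t h) x\<^sub>0 x) \<le> norm h * oint (\<lambda>t. norm (F t)) c d" by simp
  have "norm (data F Y\<^sub>0 Y\<^sub>1 h x) \<le> norm (Y\<^sub>0 h) + norm (Y\<^sub>1 h - oint (\<lambda>t. F t h) x\<^sub>0 x)"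
    unfolding data_def by (rule norm_Pair_le)
  also have "\<dots> \<le> norm (Y\<^sub>0 h) + (norm (Y\<^sub>1 h) + norm (oint (\<lambda>t. F t h) x\<^sub>0 x))"
    using norm_triangle_ineq4 by (intro add_left_mono)
  also have "\<dots> \<le> norm Y\<^sub>0 * norm h + (norm Y\<^sub>1 * norm h + norm h * oint (\<lambda>t. norm (F t)) c d)"
    by (intro add_mono norm_blinfun 1)
  finally show ?thesis by (simp add: algebra_simps)
qed

lemma data_add: "x \<in> I \<Longrightarrow> data F Y\<^sub>0 Y\<^sub>1 (h + h') x = data F Y\<^sub>0 Y\<^sub>1 h x + data F Y\<^sub>0 Y\<^sub>1 h' x"
  using oint_add[OF V.interval F.apply_L1loc F.apply_L1loc V.x0]
  by (simp add: data_def blinfun.add_right)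

lemma data_scaleC2:
  assumes Y0: "Y\<^sub>0 \<in> BH" and Y1: "Y\<^sub>1 \<in> BH" and x: "x \<in> I"
  shows "data F Y\<^sub>0 Y\<^sub>1 (c *\<^sub>C h) x = scaleC2 c (data F Y\<^sub>0 Y\<^sub>1 h x)"
proof -
  have "oint (\<lambda>t. F t (c *\<^sub>C h)) x\<^sub>0 x = oint (\<lambda>t. c *\<^sub>C F t h) x\<^sub>0 x"
    by (rule oint_cong) (simp add: BH_scaleC[OF F.in_BH] V.strong.between_mem[OF x])
  also have "\<dots> = c *\<^sub>C oint (\<lambda>t. F t h) x\<^sub>0 x"
    by (rule oint_bounded_linear[OF V.interval bounded_linear_scaleC F.apply_L1loc V.x0 x])
  finally show ?thesis
    by (simp add: data_def scaleC2_def BH_scaleC[OF Y0] BH_scaleC[OF Y1] scaleC_diff_right)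
qed

text \<open>Uniqueness makes the solution with data \<open>data F Y\<^sub>0 Y\<^sub>1 h\<close> linear in \<open>h\<close>, and Gronwall's inequality
  bounds it by a multiple of \<open>\<parallel>h\<parallel>\<close>. So for each \<open>x\<close> its two components at \<open>x\<close> are bounded operators applied to \<open>h\<close>.\<close>

lemma ivp_pair_exists:
  assumes Y0: "Y\<^sub>0 \<in> BH" and Y1: "Y\<^sub>1 \<in> BH"
  shows "\<exists>Y Y'. ivp_pair z F Y\<^sub>0 Y\<^sub>1 Y Y' \<and> (\<forall>x\<in>I. Y x \<in> BH \<and> Y' x \<in> BH)"
proof -
  have "\<forall>h. \<exists>u. phase.solves z (data F Y\<^sub>0 Y\<^sub>1 h) u"
    using phase.solves_exists[OF continuous_on_data] by blast
  then obtain u where u: "\<And>h. phase.solves z (data F Y\<^sub>0 Y\<^sub>1 h) (u h)" by metis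
  have add: "u (h + h') x = u h x + u h' x" if "x \<in> I" for h h' x
    by (rule phase.solves_unique[OF u phase.solves_add[OF u u]]) (simp_all add: data_add that)
  have scaleC: "u (c *\<^sub>C h) x = scaleC2 c (u h x)" if "x \<in> I" for c h x
    by (rule phase.solves_unique[OF u solves_scaleC2[OF u]]) (simp_all add: data_scaleC2[OF Y0 Y1] that)
  have bl: "bounded_linear (\<lambda>h. u h x)" if x: "x \<in> I" for x
  proof (rule bounded_linear_intro)
    let ?c = "min x\<^sub>0 x" and ?d = "max x\<^sub>0 x"
    let ?M = "norm Y\<^sub>0 + norm Y\<^sub>1 + oint (\<lambda>t. norm (F t)) ?c ?d"
    fix h h' and r :: real
    show "u (h + h') x = u h x + u h' x" by (rule add[OF x])
    have "scaleC2 (complex_of_real r) v = r *\<^sub>R v" for v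
      by (simp add: scaleC2_def scaleC_of_real scaleR_prod_def)
    then show "u (r *\<^sub>R h) x = r *\<^sub>R u h x"
      using scaleC[OF x, of "complex_of_real r" h] by (simp add: scaleC_of_real)
    have seg: "{?c..?d} \<subseteq> I" using V.strong.between_mem[OF x] by auto
    have "norm (u h x) \<le> growth z ?c ?d * (?M * norm h)"
      by (rule phase_norm_le[OF u seg _ _ norm_data_le[OF seg]]) auto
    then show "norm (u h x) \<le> norm h * (growth z ?c ?d * ?M)" by (simp add: mult_ac)
  qed
  define Y where "Y = (\<lambda>x. Blinfun (\<lambda>h. fst (u h x)))"
  define Y' where "Y' = (\<lambda>x. Blinfun (\<lambda>h. snd (u h x)))"
  have Y: "blinfun_apply (Y x) h = fst (u h x)" "blinfun_apply (Y' x) h = snd (u h x)" if "x \<in> I" for x h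
    unfolding Y_def Y'_def
    by (simp_all add: bounded_linear_Blinfun_apply bounded_linear_compose[OF bounded_linear_fst bl[OF that]]
        bounded_linear_compose[OF bounded_linear_snd bl[OF that]])
  have "ivp_pair z F Y\<^sub>0 Y\<^sub>1 Y Y'"
    unfolding ivp_pair_def by (rule allI, rule phase.solves_cong[OF u]) (simp_all add: Y)
  moreover have "Y x \<in> BH \<and> Y' x \<in> BH" if "x \<in> I" for x
    unfolding BH_def using scaleC[OF that] by (simp add: Y[OF that] scaleC2_def)
  ultimately show ?thesis by blast
qed

context
  fixes z and Y Y' :: "real \<Rightarrow> 'a \<Rightarrow>\<^sub>L 'a"
  assumes pair: "ivp_pair z F Y\<^sub>0 Y\<^sub>1 Y Y'"
begin

lemma pair_solves: "phase.solves z (data F Y\<^sub>0 Y\<^sub>1 h) (\<lambda>x. (Y x h, Y' x h))"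
  using pair by (simp add: ivp_pair_def)

lemma pair_continuous: "continuous_on I (\<lambda>x. Y x h)" "continuous_on I (\<lambda>x. Y' x h)"
proof -
  have c: "continuous_on I (\<lambda>x. (Y x h, Y' x h))" by (rule phase.solves_continuous[OF pair_solves])
  show "continuous_on I (\<lambda>x. Y x h)" "continuous_on I (\<lambda>x. Y' x h)"
    using continuous_on_fst[OF c] continuous_on_snd[OF c] by simp_all
qed

lemma rhs_L1loc:
  shows "(\<lambda>t. V t (Y t h)) \<in> L1loc I" "(\<lambda>t. z *\<^sub>C Y t h) \<in> L1loc I"
    "(\<lambda>t. V t (Y t h) - z *\<^sub>C Y t h - F t h) \<in> L1loc I"
proof -
  show a: "(\<lambda>t. V t (Y t h)) \<in> L1loc I" by (rule V.strong.A_comp_L1loc[OF pair_continuous(1)])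
  show b: "(\<lambda>t. z *\<^sub>C Y t h) \<in> L1loc I"
    by (intro L1loc_bounded_linear[OF bounded_linear_scaleC] L1loc_continuous pair_continuous(1))
  show "(\<lambda>t. V t (Y t h) - z *\<^sub>C Y t h - F t h) \<in> L1loc I"
    by (intro L1loc_diff a b F.apply_L1loc)
qed

lemma pair_integral_equations:
  assumes x: "x \<in> I"
  shows "Y x h = Y\<^sub>0 h + oint (\<lambda>t. Y' t h) x\<^sub>0 x"
    and "Y' x h = Y\<^sub>1 h + oint (\<lambda>t. V t (Y t h) - z *\<^sub>C Y t h - F t h) x\<^sub>0 x"
proof -
  let ?u = "\<lambda>x. (Y x h, Y' x h)"
  have u: "?u x = data F Y\<^sub>0 Y\<^sub>1 h x + oint (\<lambda>t. phase z t (?u t)) x\<^sub>0 x"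
    by (rule phase.solves_eq[OF pair_solves x])
  have L1: "(\<lambda>t. phase z t (?u t)) \<in> L1loc I"
    by (rule phase.A_comp_L1loc[OF phase.solves_continuous[OF pair_solves]])
  have "fst (oint (\<lambda>t. phase z t (?u t)) x\<^sub>0 x) = oint (\<lambda>t. Y' t h) x\<^sub>0 x"
    using oint_bounded_linear[OF V.interval bounded_linear_fst L1 V.x0 x] by (simp add: phase_def)
  then show "Y x h = Y\<^sub>0 h + oint (\<lambda>t. Y' t h) x\<^sub>0 x"
    using arg_cong[OF u, of fst] by (simp add: data_def)
  have "snd (oint (\<lambda>t. phase z t (?u t)) x\<^sub>0 x) = oint (\<lambda>t. V t (Y t h) - z *\<^sub>C Y t h) x\<^sub>0 x"
    using oint_bounded_linear[OF V.interval bounded_linear_snd L1 V.x0 x] by (simp add: phase_def)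
  then show "Y' x h = Y\<^sub>1 h + oint (\<lambda>t. V t (Y t h) - z *\<^sub>C Y t h - F t h) x\<^sub>0 x"
    using arg_cong[OF u, of snd] oint_diff[OF V.interval L1loc_diff[OF rhs_L1loc(1,2)] F.apply_L1loc V.x0 x]
    by (simp add: data_def)
qed

lemma pair_increments:
  assumes "x \<in> I" "y \<in> I"
  shows "Y y h - Y x h = oint (\<lambda>t. Y' t h) x y"
    and "Y' y h - Y' x h = oint (\<lambda>t. V t (Y t h) - z *\<^sub>C Y t h - F t h) x y"
  using assms oint_combine[OF V.interval L1loc_continuous[OF pair_continuous(2)] V.x0 assms, of h]
    oint_combine[OF V.interval rhs_L1loc(3) V.x0 assms, of h]
  by (simp_all add: pair_integral_equations algebra_simps)

lemma pair_norm_le: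
  assumes "{c..d} \<subseteq> I" "c \<le> x\<^sub>0" "x\<^sub>0 \<le> d" "x \<in> {c..d}"
  shows "norm (Y x) \<le> growth z c d * (norm Y\<^sub>0 + norm Y\<^sub>1 + oint (\<lambda>t. norm (F t)) c d)"
proof -
  have "c \<in> I" "d \<in> I" using assms by auto
  have nn: "0 \<le> oint (\<lambda>t. norm (F t)) c d"
    using oint_mono_segment[OF V.interval F.norm_L1 _ \<open>c \<in> I\<close> \<open>d \<in> I\<close>, of c d] assms by auto
  show ?thesis
  proof (rule norm_blinfun_bound)
    show "0 \<le> growth z c d * (norm Y\<^sub>0 + norm Y\<^sub>1 + oint (\<lambda>t. norm (F t)) c d)"
      using growth_pos[of z c d] nn by simp
    fix h
    have "norm (Y x h) \<le> norm (Y x h, Y' x h)"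
      using norm_fst_le[of "Y x h" "Y' x h"] by simp
    also have "\<dots> \<le> growth z c d * ((norm Y\<^sub>0 + norm Y\<^sub>1 + oint (\<lambda>t. norm (F t)) c d) * norm h)"
      by (rule phase_norm_le[OF pair_solves assms(1-3) norm_data_le[OF assms(1-3)] assms(4)])
    finally show "norm (Y x h) \<le> growth z c d * (norm Y\<^sub>0 + norm Y\<^sub>1 + oint (\<lambda>t. norm (F t)) c d) * norm h"
      by (simp add: mult.assoc)
  qed
qed

text \<open>Near \<open>x\<close>, \<open>Y\<close> is bounded by a constant \<open>M\<close> in operator norm, and so \<open>\<parallel>Y'' h\<parallel>\<close> is at most \<open>\<parallel>h\<parallel>\<close> times the locally
  integrable function \<open>M \<parallel>V\<parallel> + M \<bar>z\<bar> + \<parallel>F\<parallel>\<close>. Its integral bounds the increments of \<open>Y'\<close> uniformly in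
  \<open>\<parallel>h\<parallel> \<le> 1\<close>.\<close>

lemma pair_derivative_norm_continuous: "continuous_on I Y'"
proof (rule continuous_at_imp_continuous_on, rule ballI)
  fix x assume x: "x \<in> I"
  obtain c d where cd: "{c..d} \<subseteq> I" "c \<le> x\<^sub>0" "x\<^sub>0 \<le> d" "c < x" "x < d"
    using V.strong.enclosing_segment[OF x] by metis
  obtain M where M: "\<And>t. t \<in> {c..d} \<Longrightarrow> norm (Y t) \<le> M"
    using pair_norm_le[OF cd(1-3)] by blast
  define g where "g = (\<lambda>t. M * norm (V t) + M * cmod z + norm (F t))"
  have g: "g \<in> L1loc I"
    unfolding g_def
    using L1loc_add[OF L1loc_add[OF L1loc_scaleR[OF V.norm_L1, of M]
        L1loc_continuous[OF continuous_on_const, of "M * cmod z"]] F.norm_L1] by simp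
  have le: "norm (Y' y - Y' x) \<le> \<bar>oint g x y\<bar>" if y: "y \<in> {c..d}" for y
  proof (rule norm_blinfun_bound)
    fix h
    have yI: "y \<in> I" using y cd by auto
    have "norm (Y' y h - Y' x h) \<le> \<bar>oint (\<lambda>t. norm h *\<^sub>R g t) x y\<bar>"
      unfolding pair_increments(2)[OF x yI]
    proof (rule oint_norm_le[OF V.interval rhs_L1loc(3) L1loc_scaleR[OF g] x yI])
      fix t assume "min x y \<le> t" "t \<le> max x y"
      then have t: "t \<in> {c..d}" using y cd by (auto simp: min_def max_def split: if_splits)
      have Yth: "norm (Y t h) \<le> M * norm h"
        using norm_blinfun[of "Y t" h] mult_right_mono[OF M[OF t] norm_ge_zero[of h]] by linarith
      have "norm (V t (Y t h) - z *\<^sub>C Y t h - F t h) \<le> norm (V t (Y t h)) + norm (z *\<^sub>C Y t h) + norm (F t h)"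
        using norm_triangle_ineq4[of "V t (Y t h) - z *\<^sub>C Y t h" "F t h"]
          norm_triangle_ineq4[of "V t (Y t h)" "z *\<^sub>C Y t h"] by linarith
      also have "\<dots> \<le> norm (V t) * (M * norm h) + cmod z * (M * norm h) + norm (F t) * norm h"
        unfolding norm_scaleC
        by (intro add_mono norm_blinfun mult_left_mono Yth order_trans[OF norm_blinfun]) auto
      finally show "norm (V t (Y t h) - z *\<^sub>C Y t h - F t h) \<le> norm h *\<^sub>R g t"
        by (simp add: g_def algebra_simps)
    qed
    then show "norm ((Y' y - Y' x) h) \<le> \<bar>oint g x y\<bar> * norm h"
      by (simp add: blinfun.diff_left abs_mult mult.commute)
  qed simp
  have "isCont (oint g x) x"
    using continuous_on_oint[OF V.interval g V.openI x] V.openI x continuous_on_eq_continuous_at by blast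
  then have lim: "((\<lambda>y. oint g x y) \<longlongrightarrow> 0) (at x)"
    by (simp add: isCont_def)
  have "((\<lambda>y. Y' y - Y' x) \<longlongrightarrow> 0) (at x)"
  proof (rule Lim_null_comparison)
    have "\<forall>\<^sub>F y in at x. y \<in> {c<..<d}"
      by (rule eventually_at_in_open') (use cd in auto)
    then show "\<forall>\<^sub>F y in at x. norm (Y' y - Y' x) \<le> \<bar>oint g x y\<bar>"
      by eventually_elim (rule le, auto)
    show "((\<lambda>y. \<bar>oint g x y\<bar>) \<longlongrightarrow> 0) (at x)"
      by (rule tendsto_rabs_zero[OF lim])
  qed
  then show "isCont Y' x" by (simp add: isCont_def LIM_zero_iff)
qed

text \<open>Strong differentiability improves to norm differentiability because \<open>Y'\<close> is norm continuous: the
  increment of \<open>Y h - (\<cdot>) Y'(x) h\<close> is the integral of \<open>(Y' - Y'(x)) h\<close>.\<close>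

lemma pair_has_vector_derivative:
  assumes x: "x \<in> I"
  shows "(Y has_vector_derivative Y' x) (at x)"
  unfolding has_vector_derivative_def has_derivative_within_alt2
proof (intro conjI allI impI bounded_linear_scaleR_left)
  fix e :: real assume e: "e > 0"
  have "isCont Y' x"
    using pair_derivative_norm_continuous V.openI x continuous_on_eq_continuous_at by blast
  then obtain r where r: "r > 0" "\<And>t. dist t x < r \<Longrightarrow> dist (Y' t) (Y' x) < e"
    using e unfolding continuous_at_eps_delta by blast
  have "\<forall>\<^sub>F y in at x. y \<in> I \<inter> ball x r"
    by (rule eventually_at_in_open') (use V.openI x r in auto)
  then show "\<forall>\<^sub>F y in at x. norm (Y y - Y x - (y - x) *\<^sub>R Y' x) \<le> e * norm (y - x)"
  proof eventually_elim
    case (elim y)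
    show ?case
    proof (rule norm_blinfun_bound)
      fix h
      have L1: "(\<lambda>t. Y' t h - Y' x h) \<in> L1loc I"
        by (intro L1loc_continuous continuous_intros pair_continuous(2))
      have "(Y y - Y x - (y - x) *\<^sub>R Y' x) h = oint (\<lambda>t. Y' t h - Y' x h) x y"
        using oint_diff[OF V.interval L1loc_continuous[OF pair_continuous(2)]
            L1loc_continuous[OF continuous_on_const] x, of y h "Y' x h"] elim
          pair_increments(1)[OF x, of y h]
        by (simp add: oint_const blinfun.diff_left blinfun.scaleR_left)
      also have "norm \<dots> \<le> \<bar>oint (\<lambda>_. e * norm h) x y\<bar>"
      proof (rule oint_norm_le[OF V.interval L1 L1loc_continuous[OF continuous_on_const] x])
        fix t assume "min x y \<le> t" "t \<le> max x y"
        then have "dist t x < r" using elim by (auto simp: dist_real_def min_def max_def split: if_splits)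
        then have "norm (Y' t - Y' x) \<le> e" using r(2)[of t] by (simp add: dist_norm)
        then have "norm ((Y' t - Y' x) h) \<le> e * norm h"
          using norm_blinfun[of "Y' t - Y' x" h] mult_right_mono[of "norm (Y' t - Y' x)" e "norm h"] by simp
        then show "norm (Y' t h - Y' x h) \<le> e * norm h" by (simp add: blinfun.diff_left)
      qed (use elim in auto)
      also have "\<dots> = e * norm (y - x) * norm h" using e by (simp add: oint_const abs_mult)
      finally show "norm ((Y y - Y x - (y - x) *\<^sub>R Y' x) h) \<le> e * norm (y - x) * norm h" .
    qed (use e in simp)
  qed
qed

lemma pair_is_ivp_solution:
  assumes BH: "\<And>x. x \<in> I \<Longrightarrow> Y x \<in> BH"
  shows "is_ivp_solution I (\<lambda>x. V x - cscale z) F x\<^sub>0 Y\<^sub>0 Y\<^sub>1 Y"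
  unfolding is_ivp_solution_def is_solution_def
proof (intro conjI ballI allI)
  show "Y x\<^sub>0 = Y\<^sub>0" 
    by (rule blinfun_eqI) (use pair_integral_equations(1)[OF V.x0] in simp)
  have Y1: "Y' x\<^sub>0 = Y\<^sub>1"
    by (rule blinfun_eqI) (use pair_integral_equations(2)[OF V.x0] in simp)
  show "has_strong_derivative Y Y\<^sub>1 x\<^sub>0"
    unfolding has_strong_derivative_def
  proof
    fix h
    show "((\<lambda>t. Y t h) has_vector_derivative Y\<^sub>1 h) (at x\<^sub>0)"
      using bounded_linear.has_vector_derivative[OF blinfun.bounded_linear_left
          pair_has_vector_derivative[OF V.x0], of h] by (simp add: Y1)
  qed
next
  fix h
  let ?y'' = "\<lambda>t. V t (Y t h) - z *\<^sub>C Y t h - F t h"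
  have "W21loc_derivs I (\<lambda>x. Y x h) (\<lambda>x. Y' x h) ?y''"
    unfolding W21loc_derivs_def
    by (auto simp flip: pair_increments intro: rhs_L1loc(3) L1loc_continuous pair_continuous(2))
  moreover have "AE x in lebesgue. x \<in> I \<longrightarrow> - ?y'' x + (V x - cscale z) (Y x h) = F x h"
    by (simp add: blinfun.diff_left cscale.rep_eq)
  ultimately show "\<exists>y' y''. W21loc_derivs I (\<lambda>x. Y x h) y' y'' \<and>
      (AE x in lebesgue. x \<in> I \<longrightarrow> - y'' x + (V x - cscale z) (Y x h) = F x h)"
    by blast
qed (rule BH)

text \<open>A solution in the sense of the definition has a continuous derivative \<open>y'\<close>, so that its strong
  derivative at \<open>x\<^sub>0\<close> is \<open>y' x\<^sub>0\<close>. Together with the equation, which determines \<open>y''\<close> almost everywhere, this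
  shows that \<open>(U h, y')\<close> solves the same phase-space equation as \<open>(Y h, Y' h)\<close>.\<close>

lemma ivp_solution_unique:
  assumes U: "is_ivp_solution I (\<lambda>x. V x - cscale z) F x\<^sub>0 Y\<^sub>0 Y\<^sub>1 U" and x: "x \<in> I"
  shows "U x = Y x"
proof (rule blinfun_eqI)
  fix h
  obtain y' y'' where W: "W21loc_derivs I (\<lambda>x. U x h) y' y''"
    and ae: "AE x in lebesgue. x \<in> I \<longrightarrow> - y'' x + (V x - cscale z) (U x h) = F x h"
    using U unfolding is_ivp_solution_def is_solution_def by blast
  have y''L1: "y'' \<in> L1loc I" and y': "y' t = y' x\<^sub>0 + oint y'' x\<^sub>0 t"
    and y: "U t h = U x\<^sub>0 h + oint y' x\<^sub>0 t" if "t \<in> I" for t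
    using W V.x0 that unfolding W21loc_derivs_def by blast+
  note y''L1 = y''L1[OF V.x0]
  have cont': "continuous_on I y'"
    using continuous_on_oint[OF V.interval y''L1 V.openI V.x0]
    by (subst continuous_on_cong[OF refl y']) (auto intro: continuous_intros)
  have cont: "continuous_on I (\<lambda>t. U t h)"
    using continuous_on_oint[OF V.interval L1loc_continuous[OF cont'] V.openI V.x0]
    by (subst continuous_on_cong[OF refl y]) (auto intro: continuous_intros)
  have "((\<lambda>t. U x\<^sub>0 h + oint y' x\<^sub>0 t) has_vector_derivative y' x\<^sub>0) (at x\<^sub>0)"
    using oint_has_vector_derivative_continuous[OF V.interval V.openI cont' V.x0 V.x0]
    by (auto intro!: derivative_eq_intros)
  then have "((\<lambda>t. U t h) has_vector_derivative y' x\<^sub>0) (at x\<^sub>0)"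
    by (rule has_vector_derivative_transform_within_open[OF _ V.openI V.x0]) (simp add: y)
  moreover have "((\<lambda>t. U t h) has_vector_derivative Y\<^sub>1 h) (at x\<^sub>0)"
    using U by (simp add: is_ivp_solution_def has_strong_derivative_def)
  ultimately have y'0: "y' x\<^sub>0 = Y\<^sub>1 h" by (rule vector_derivative_unique_at)
  have U0: "U x\<^sub>0 = Y\<^sub>0" using U by (simp add: is_ivp_solution_def)
  have contu: "continuous_on I (\<lambda>t. (U t h, y' t))" by (intro continuous_intros cont cont')
  note L1 = phase.A_comp_L1loc[OF contu, of z]
  have "phase.solves z (data F Y\<^sub>0 Y\<^sub>1 h) (\<lambda>t. (U t h, y' t))"
    unfolding phase.solves_def
  proof (intro conjI ballI contu)
    fix x assume x: "x \<in> I"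
    have "AE t in lebesgue. t \<in> I \<longrightarrow> y'' t = snd (phase z t (U t h, y' t)) - F t h"
      using ae by eventually_elim (auto simp: phase_def blinfun.diff_left cscale.rep_eq algebra_simps)
    then have "oint y'' x\<^sub>0 x = oint (\<lambda>t. snd (phase z t (U t h, y' t)) - F t h) x\<^sub>0 x"
      by (intro oint_cong_AE[OF V.interval y''L1 _ V.x0 x] L1loc_diff F.apply_L1loc
          L1loc_bounded_linear[OF bounded_linear_snd L1])
    also have "\<dots> = oint (\<lambda>t. snd (phase z t (U t h, y' t))) x\<^sub>0 x - oint (\<lambda>t. F t h) x\<^sub>0 x"
      by (rule oint_diff[OF V.interval L1loc_bounded_linear[OF bounded_linear_snd L1] F.apply_L1loc V.x0 x])
    also have "oint (\<lambda>t. snd (phase z t (U t h, y' t))) x\<^sub>0 x = snd (oint (\<lambda>t. phase z t (U t h, y' t)) x\<^sub>0 x)"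
      by (rule oint_bounded_linear[OF V.interval bounded_linear_snd L1 V.x0 x])
    finally have 2: "y' x = Y\<^sub>1 h - oint (\<lambda>t. F t h) x\<^sub>0 x + snd (oint (\<lambda>t. phase z t (U t h, y' t)) x\<^sub>0 x)"
      using y'[OF x] y'0 by simp
    have "oint y' x\<^sub>0 x = fst (oint (\<lambda>t. phase z t (U t h, y' t)) x\<^sub>0 x)"
      using oint_bounded_linear[OF V.interval bounded_linear_fst L1 V.x0 x] by (simp add: phase_def)
    then have 1: "U x h = Y\<^sub>0 h + fst (oint (\<lambda>t. phase z t (U t h, y' t)) x\<^sub>0 x)"
      using y[OF x] U0 by simp
    show "(U x h, y' x) = data F Y\<^sub>0 Y\<^sub>1 h x + oint (\<lambda>t. phase z t (U t h, y' t)) x\<^sub>0 x"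
      by (rule prod_eqI) (simp_all add: data_def 1[symmetric] 2[symmetric] plus_prod_def)
  qed
  from phase.solves_unique[OF this pair_solves _ x] show "U x h = Y x h" by simp
qed

end
end

end

section \<open>Dependence on the spectral parameter and the exceptional null set\<close>

text \<open>The real part of the inner product is expressed by norms through polarization, and the
  imaginary part is the real part of the inner product with \<open>-\<i> y\<close>.\<close>

lemma continuous_on_cinner_right:
  fixes y :: "'t::topological_space \<Rightarrow> 'a::complex_hilbert"
  assumes y: "continuous_on S y"
  shows "continuous_on S (\<lambda>t. cinner x (y t))"
proof -
  have Re: "continuous_on S (\<lambda>t. Re (cinner x (y t)))" if "continuous_on S y" for y
  proof -
    have "Re (cinner x (y t)) = ((norm (y t))\<^sup>2 + (norm x)\<^sup>2 - (norm (y t - x))\<^sup>2) / 2" for t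
      by (simp add: norm_diff_power2_cinner)
    then show ?thesis using that by (simp only:) (intro continuous_intros, auto)
  qed
  have "Im (cinner x (y t)) = Re (cinner x ((- \<i>) *\<^sub>C y t))" for t
    by (simp add: cinner_scaleC_right)
  then have "cinner x (y t) = of_real (Re (cinner x (y t))) + \<i> * of_real (Re (cinner x ((- \<i>) *\<^sub>C y t)))" for t
    using complex_eq[of "cinner x (y t)"] by simp
  moreover have "continuous_on S (\<lambda>t. of_real (Re (cinner x (y t))) + \<i> * of_real (Re (cinner x ((- \<i>) *\<^sub>C y t))))"
    by (intro continuous_intros Re y bounded_linear.continuous_on[OF bounded_linear_scaleC])
  ultimately show ?thesis by simp
qed

lemma L1loc_operator_continuous:
  fixes G :: "real \<Rightarrow> 'a::separable_complex_hilbert \<Rightarrow>\<^sub>L 'a"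
  assumes "is_interval I" "open I" "x\<^sub>0 \<in> I" "continuous_on I G" "\<And>t. t \<in> I \<Longrightarrow> G t \<in> BH"
  shows "L1loc_operator I x\<^sub>0 G"
proof
  show "weakly_measurable_on I G"
    unfolding weakly_measurable_on_def
  proof (intro allI)
    fix f g
    have "continuous_on I (\<lambda>t. cinner f (G t g))"
      by (intro continuous_on_cinner_right continuous_intros assms(4))
    then show "(\<lambda>t. cinner f (G t g)) \<in> borel_measurable (lebesgue_on I)"
      by (rule continuous_imp_measurable_on_sets_lebesgue) (use assms(2) in auto)
  qed
  show "(\<lambda>t. norm (G t)) \<in> L1loc I"
    by (intro L1loc_continuous continuous_on_norm assms(4))
qed (use assms in auto)

context operator_ivp
begin

text \<open>\<open>D\<close> is the candidate for the \<open>z\<close>-derivative. In a first step, \<open>Y w - Y z\<close> solves the equation with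
  parameter \<open>z\<close> and forcing \<open>(w - z) Y w\<close>, hence is \<open>O(\<bar>w - z\<bar>)\<close> by Gronwall's inequality. In a
  second step, the difference quotient minus \<open>D\<close> solves it with forcing \<open>Y w - Y z\<close>, hence
  is \<open>O(\<bar>w - z\<bar>)\<close> as well. Both bounds are uniform for \<open>\<bar>w - z\<bar> \<le> 1\<close> and proportional to \<open>\<parallel>h\<parallel>\<close>.\<close>

lemma ivp_pair_difference_quotient:
  fixes F :: "real \<Rightarrow> 'a \<Rightarrow>\<^sub>L 'a" and Y Y' :: "complex \<Rightarrow> real \<Rightarrow> 'a \<Rightarrow>\<^sub>L 'a"
  assumes F: "L1loc_operator I x\<^sub>0 F"
    and pair: "\<And>w. ivp_pair w F Y\<^sub>0 Y\<^sub>1 (Y w) (Y' w)"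
    and dpair: "ivp_pair z (Y z) 0 0 D D'" and x: "x \<in> I"
  shows "\<exists>L. \<forall>w h. cmod (w - z) \<le> 1 \<longrightarrow> w \<noteq> z \<longrightarrow>
    norm (scaleC2 (1 / (w - z)) (Y w x h - Y z x h, Y' w x h - Y' z x h) - (D x h, D' x h))
      \<le> L * cmod (w - z) * norm h"
proof -
  define c where "c = min x\<^sub>0 x"
  define d where "d = max x\<^sub>0 x"
  have cd: "{c..d} \<subseteq> I" "c \<le> x\<^sub>0" "x\<^sub>0 \<le> d" "x \<in> {c..d}" "c \<in> I" "d \<in> I" "c \<le> d"
    using V.strong.between_mem[OF x] x V.x0 by (auto simp: c_def d_def min_def max_def)
  \<comment> \<open>One growth constant for all \<open>w\<close> in the closed unit disc around \<open>z\<close>.\<close>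
  define Z where "Z = complex_of_real (cmod z + 1)"
  define C where "C = growth Z c d"
  define M where "M = C * (norm Y\<^sub>0 + norm Y\<^sub>1 + oint (\<lambda>t. norm (F t)) c d)"
  have growth_le: "growth w c d \<le> C" if "cmod (w - z) \<le> 1" for w
  proof -
    have "cmod w \<le> cmod Z" using that norm_triangle_ineq2[of w z] by (simp add: Z_def)
    then show ?thesis unfolding C_def using cd by (intro growth_mono) auto
  qed
  have C0: "C > 0" unfolding C_def by (rule growth_pos)
  have nn: "0 \<le> oint (\<lambda>t. norm (F t)) c d"
    using oint_mono_segment[OF V.interval L1loc_operator.norm_L1[OF F] _ cd(5,6), of c d] cd by auto
  have M: "norm (Y w t) \<le> M" if "cmod (w - z) \<le> 1" "t \<in> {c..d}" for w t
  proof -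
    have "norm (Y w t) \<le> growth w c d * (norm Y\<^sub>0 + norm Y\<^sub>1 + oint (\<lambda>t. norm (F t)) c d)"
      by (rule pair_norm_le[OF F pair cd(1-3) that(2)])
    also have "\<dots> \<le> M" unfolding M_def using nn by (intro mult_right_mono growth_le that(1)) auto
    finally show ?thesis .
  qed
  have M0: "0 \<le> M" using order_trans[OF norm_ge_zero M[of z x]] cd(4) by simp
  have YL1: "(\<lambda>t. Y w t h) \<in> L1loc I" for w h
    by (rule L1loc_continuous[OF pair_continuous(1)[OF F pair]])
  have oint_le: "norm (oint f x\<^sub>0 t) \<le> (d - c) * B"
    if f: "f \<in> L1loc I" "\<And>s. s \<in> {c..d} \<Longrightarrow> norm (f s) \<le> B" and t: "t \<in> {c..d}" for f :: "real \<Rightarrow> 'a" and t B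
  proof -
    have tI: "t \<in> I" using t cd by auto
    have "0 \<le> B" using f(2)[OF t] norm_ge_zero[of "f t"] by linarith
    have "norm (oint f x\<^sub>0 t) \<le> \<bar>oint (\<lambda>_. B) x\<^sub>0 t\<bar>"
      by (rule oint_norm_le[OF V.interval f(1) L1loc_continuous[OF continuous_on_const] V.x0 tI])
        (rule f(2), use cd t in auto)
    also have "\<dots> = \<bar>t - x\<^sub>0\<bar> * B" using \<open>0 \<le> B\<close> by (simp add: oint_const abs_mult)
    also have "\<dots> \<le> (d - c) * B" using cd t \<open>0 \<le> B\<close> by (intro mult_right_mono) auto
    finally show ?thesis .
  qed
  have dc: "0 \<le> d - c" using cd by simp
  have u_diff: "phase.solves z (\<lambda>x. - (0, (w - z) *\<^sub>C oint (\<lambda>t. Y w t h) x\<^sub>0 x))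
      (\<lambda>x. (Y w x h - Y z x h, Y' w x h - Y' z x h))" for w h
  proof -
    have "phase.solves z (\<lambda>x. data F Y\<^sub>0 Y\<^sub>1 h x - (0, (w - z) *\<^sub>C oint (\<lambda>t. fst (Y w t h, Y' w t h)) x\<^sub>0 x)
        - data F Y\<^sub>0 Y\<^sub>1 h x) (\<lambda>x. (Y w x h, Y' w x h) - (Y z x h, Y' z x h))"
      by (rule phase.solves_diff[OF phase_change_parameter[OF pair_solves[OF F pair]]
            pair_solves[OF F pair]])
    then show ?thesis by simp
  qed
  define L where "L = C * ((d - c) * M)"
  have Y_diff: "norm (Y w t h - Y z t h) \<le> L * cmod (w - z) * norm h"
    if w: "cmod (w - z) \<le> 1" and t: "t \<in> {c..d}" for w t h
  proof -
    have "norm (Y w t h - Y z t h) \<le> norm (Y w t h - Y z t h, Y' w t h - Y' z t h)"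
      by (rule norm_fst_le)
    also have "\<dots> \<le> growth z c d * (cmod (w - z) * ((d - c) * (M * norm h)))"
    proof (rule phase_norm_le[OF u_diff cd(1-3) _ t])
      fix s assume s: "s \<in> {c..d}"
      have "norm (Y w r h) \<le> M * norm h" if "r \<in> {c..d}" for r
        using norm_blinfun[of "Y w r" h] mult_right_mono[OF M[OF w that] norm_ge_zero[of h]] by linarith
      then have "norm (oint (\<lambda>t. Y w t h) x\<^sub>0 s) \<le> (d - c) * (M * norm h)"
        using s by (intro oint_le YL1) auto
      then show "norm (- (0 :: 'a, (w - z) *\<^sub>C oint (\<lambda>t. Y w t h) x\<^sub>0 s)) \<le> cmod (w - z) * ((d - c) * (M * norm h))"
        by (simp add: norm_Pair norm_scaleC mult_left_mono)
    qed
    also have "\<dots> \<le> C * (cmod (w - z) * ((d - c) * (M * norm h)))"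
      using growth_le[of z] M0 dc by (intro mult_right_mono) auto
    finally show ?thesis by (simp add: L_def mult_ac)
  qed
  have "norm (scaleC2 (1 / (w - z)) (Y w x h - Y z x h, Y' w x h - Y' z x h) - (D x h, D' x h))
      \<le> C * ((d - c) * L) * cmod (w - z) * norm h" if w: "cmod (w - z) \<le> 1" "w \<noteq> z" for w h
  proof -
    define v where "v = (\<lambda>x. scaleC2 (1 / (w - z)) (- (0 :: 'a, (w - z) *\<^sub>C oint (\<lambda>t. Y w t h) x\<^sub>0 x)) - data (Y z) 0 0 h x)"
    have "phase.solves z v (\<lambda>x. scaleC2 (1 / (w - z)) (Y w x h - Y z x h, Y' w x h - Y' z x h) - (D x h, D' x h))"
      unfolding v_def
      using dpair by (intro phase.solves_diff solves_scaleC2 u_diff) (simp add: ivp_pair_def)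
    then have "norm (scaleC2 (1 / (w - z)) (Y w x h - Y z x h, Y' w x h - Y' z x h) - (D x h, D' x h))
        \<le> growth z c d * ((d - c) * (L * cmod (w - z) * norm h))"
    proof (rule phase_norm_le[OF _ cd(1-3) _ cd(4)])
      fix s assume s: "s \<in> {c..d}"
      have sI: "s \<in> I" using s cd by auto
      have "v s = - (0, oint (\<lambda>t. Y w t h - Y z t h) x\<^sub>0 s)"
        using w(2) oint_diff[OF V.interval YL1 YL1 V.x0 sI]
        by (simp add: v_def scaleC2_def data_def scaleC_minus_right scaleC_scaleC scaleC_1)
      then have "norm (v s) = norm (oint (\<lambda>t. Y w t h - Y z t h) x\<^sub>0 s)" by (simp add: norm_Pair)
      also have "\<dots> \<le> (d - c) * (L * cmod (w - z) * norm h)"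
        using s by (intro oint_le L1loc_diff YL1 Y_diff w(1))
      finally show "norm (v s) \<le> (d - c) * (L * cmod (w - z) * norm h)" .
    qed
    also have "\<dots> \<le> C * ((d - c) * (L * cmod (w - z) * norm h))"
      using growth_le[of z] M0 dc C0 by (intro mult_right_mono) (auto simp: L_def)
    finally show ?thesis by (simp add: mult_ac)
  qed
  then show ?thesis by blast
qed

lemma ivp_pair_entire:
  fixes F :: "real \<Rightarrow> 'a \<Rightarrow>\<^sub>L 'a" and Y Y' :: "complex \<Rightarrow> real \<Rightarrow> 'a \<Rightarrow>\<^sub>L 'a"
  assumes F: "L1loc_operator I x\<^sub>0 F"
    and pair: "\<And>z. ivp_pair z F Y\<^sub>0 Y\<^sub>1 (Y z) (Y' z)"
    and BH: "\<And>z t. t \<in> I \<Longrightarrow> Y z t \<in> BH" and x: "x \<in> I"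
  shows "entire_BH (\<lambda>z. Y z x)" "entire_BH (\<lambda>z. Y' z x)"
proof -
  have "\<exists>D\<in>BH. \<exists>D'\<in>BH. ((\<lambda>w. cscale (1 / (w - z)) o\<^sub>L (Y w x - Y z x)) \<longlongrightarrow> D) (at z) \<and>
      ((\<lambda>w. cscale (1 / (w - z)) o\<^sub>L (Y' w x - Y' z x)) \<longlongrightarrow> D') (at z)" for z
  proof -
    have Yz: "L1loc_operator I x\<^sub>0 (Y z)"
    proof (rule L1loc_operator_continuous[OF V.interval V.openI V.x0 _ BH])
      show "continuous_on I (Y z)"
        by (intro continuous_at_imp_continuous_on ballI has_vector_derivative_continuous[OF
            pair_has_vector_derivative[OF F pair]])
    qed
    have zero: "0 \<in> BH" by (simp add: BH_def)
    obtain D D' where D: "ivp_pair z (Y z) 0 0 D D'" "D x \<in> BH" "D' x \<in> BH"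
      using ivp_pair_exists[OF Yz zero zero, of z] x by blast
    obtain L where L: "\<And>w h. cmod (w - z) \<le> 1 \<Longrightarrow> w \<noteq> z \<Longrightarrow>
      norm (scaleC2 (1 / (w - z)) (Y w x h - Y z x h, Y' w x h - Y' z x h) - (D x h, D' x h))
        \<le> L * cmod (w - z) * norm h"
      using ivp_pair_difference_quotient[OF F pair D(1) x] by blast
    have near: "\<forall>\<^sub>F w in at z. cmod (w - z) \<le> 1 \<and> w \<noteq> z"
      unfolding eventually_at by (rule exI[of _ 1]) (auto simp: dist_norm)
    have lim0: "((\<lambda>w. \<bar>L\<bar> * cmod (w - z)) \<longlongrightarrow> 0) (at z)"
      by (auto intro!: tendsto_eq_intros)
    have bound: "norm ((cscale (1 / (w - z)) o\<^sub>L (Y w x - Y z x)) - D x) \<le> \<bar>L\<bar> * cmod (w - z)"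
      "norm ((cscale (1 / (w - z)) o\<^sub>L (Y' w x - Y' z x)) - D' x) \<le> \<bar>L\<bar> * cmod (w - z)"
      if w: "cmod (w - z) \<le> 1" "w \<noteq> z" for w
    proof -
      have le: "norm (((1 / (w - z)) *\<^sub>C (Y w x h - Y z x h) - D x h, (1 / (w - z)) *\<^sub>C (Y' w x h - Y' z x h) - D' x h))
          \<le> \<bar>L\<bar> * cmod (w - z) * norm h" for h
      proof -
        have "L * cmod (w - z) * norm h \<le> \<bar>L\<bar> * cmod (w - z) * norm h"
          by (intro mult_right_mono) auto
        then show ?thesis using L[OF w, of h] by (simp add: scaleC2_def)
      qed
      show "norm ((cscale (1 / (w - z)) o\<^sub>L (Y w x - Y z x)) - D x) \<le> \<bar>L\<bar> * cmod (w - z)"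
      proof (rule norm_blinfun_bound)
        show "norm (((cscale (1 / (w - z)) o\<^sub>L (Y w x - Y z x)) - D x) h) \<le> \<bar>L\<bar> * cmod (w - z) * norm h" for h
          using order_trans[OF norm_fst_le le[of h]] by (simp add: blinfun.diff_left cscale.rep_eq)
      qed simp
      show "norm ((cscale (1 / (w - z)) o\<^sub>L (Y' w x - Y' z x)) - D' x) \<le> \<bar>L\<bar> * cmod (w - z)"
      proof (rule norm_blinfun_bound)
        show "norm (((cscale (1 / (w - z)) o\<^sub>L (Y' w x - Y' z x)) - D' x) h) \<le> \<bar>L\<bar> * cmod (w - z) * norm h" for h
          using order_trans[OF norm_snd_le le[of h]] by (simp add: blinfun.diff_left cscale.rep_eq)
      qed simp
    qed
    have "((\<lambda>w. (cscale (1 / (w - z)) o\<^sub>L (Y w x - Y z x)) - D x) \<longlongrightarrow> 0) (at z)"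
      by (rule Lim_null_comparison[OF eventually_mono[OF near] lim0]) (use bound in blast)
    moreover have "((\<lambda>w. (cscale (1 / (w - z)) o\<^sub>L (Y' w x - Y' z x)) - D' x) \<longlongrightarrow> 0) (at z)"
      by (rule Lim_null_comparison[OF eventually_mono[OF near] lim0]) (use bound in blast)
    ultimately show ?thesis using D(2,3) by (auto simp: LIM_zero_iff)
  qed
  then show "entire_BH (\<lambda>z. Y z x)" "entire_BH (\<lambda>z. Y' z x)"
    unfolding entire_BH_def by blast+
qed

text \<open>The null set is found before \<open>z\<close>, \<open>Y\<close> and \<open>Y'\<close> are given: it is the union of the sets that
  \<open>oint_A_has_vector_derivative_ae\<close> provides for \<open>V\<close> and for \<open>F\<close>. The remaining term \<open>z Y h\<close> is
  continuous and adds no exceptional points.\<close>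

lemma pair_has_strong_derivative_ae:
  fixes F :: "real \<Rightarrow> 'a \<Rightarrow>\<^sub>L 'a"
  assumes F: "L1loc_operator I x\<^sub>0 F"
  shows "\<exists>E. negligible E \<and> (\<forall>z Y Y'. ivp_pair z F Y\<^sub>0 Y\<^sub>1 Y Y' \<longrightarrow>
    (\<forall>x\<in>I - E. has_strong_derivative Y' (((V x - cscale z) o\<^sub>L Y x) - F x) x))"
proof -
  interpret F: L1loc_operator I x\<^sub>0 F by (rule F)
  obtain N where N: "negligible N" "\<And>x u. x \<in> I - N \<Longrightarrow> continuous_on I u \<Longrightarrow>
      (oint (\<lambda>t. V t (u t)) x\<^sub>0 has_vector_derivative V x (u x)) (at x)"
    using V.strong.oint_A_has_vector_derivative_ae by blast
  obtain N' where N': "negligible N'" "\<And>x u. x \<in> I - N' \<Longrightarrow> continuous_on I u \<Longrightarrow>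
      (oint (\<lambda>t. F t (u t)) x\<^sub>0 has_vector_derivative F x (u x)) (at x)"
    using F.strong.oint_A_has_vector_derivative_ae by blast
  have "has_strong_derivative Y' (((V x - cscale z) o\<^sub>L Y x) - F x) x"
    if pair: "ivp_pair z F Y\<^sub>0 Y\<^sub>1 Y Y'" and x: "x \<in> I - (N \<union> N')" for z Y Y' x
    unfolding has_strong_derivative_def
  proof
    fix h
    note rhs = rhs_L1loc[OF F pair, of h] and cont = pair_continuous(1)[OF F pair, of h]
    have contz: "continuous_on I (\<lambda>t. z *\<^sub>C Y t h)"
      by (rule bounded_linear.continuous_on[OF bounded_linear_scaleC cont])
    have xI: "x \<in> I" using x by simp
    have "((\<lambda>t. Y\<^sub>1 h + (oint (\<lambda>t. V t (Y t h)) x\<^sub>0 t - oint (\<lambda>t. z *\<^sub>C Y t h) x\<^sub>0 t - oint (\<lambda>t. F t h) x\<^sub>0 t))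
        has_vector_derivative 0 + (V x (Y x h) - z *\<^sub>C Y x h - F x h)) (at x)"
      using N(2)[OF _ cont, of x] N'(2)[OF _ continuous_on_const, of x h] x
        oint_has_vector_derivative_continuous[OF V.interval V.openI contz V.x0 xI]
      by (intro has_vector_derivative_add has_vector_derivative_diff has_vector_derivative_const) auto
    then have "((\<lambda>t. Y' t h) has_vector_derivative 0 + (V x (Y x h) - z *\<^sub>C Y x h - F x h)) (at x)"
    proof (rule has_vector_derivative_transform_within_open[OF _ V.openI xI])
      fix t assume t: "t \<in> I"
      show "Y\<^sub>1 h + (oint (\<lambda>t. V t (Y t h)) x\<^sub>0 t - oint (\<lambda>t. z *\<^sub>C Y t h) x\<^sub>0 t - oint (\<lambda>t. F t h) x\<^sub>0 t) = Y' t h"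
        unfolding pair_integral_equations(2)[OF F pair t]
          oint_diff[OF V.interval L1loc_diff[OF rhs(1,2)] F.apply_L1loc V.x0 t]
          oint_diff[OF V.interval rhs(1,2) V.x0 t] ..
    qed
    then show "((\<lambda>t. Y' t h) has_vector_derivative (((V x - cscale z) o\<^sub>L Y x) - F x) h) (at x)"
      by (simp add: blinfun.diff_left cscale.rep_eq)
  qed
  moreover have "negligible (N \<union> N')" using N(1) N'(1) by (rule negligible_Un)
  ultimately show ?thesis by blast
qed

end

theorem corollary2p5:
  fixes a b :: ereal and x\<^sub>0 :: real
    and V F :: "real \<Rightarrow> 'a::separable_complex_hilbert \<Rightarrow>\<^sub>L 'a"
    and Y\<^sub>0 Y\<^sub>1 :: "'a \<Rightarrow>\<^sub>L 'a"
    and I :: "real set"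
  assumes "I = einterval a b" and "x\<^sub>0 \<in> I"
    and "Y\<^sub>0 \<in> BH" and "Y\<^sub>1 \<in> BH"
    and "\<And>x. x \<in> I \<Longrightarrow> V x \<in> BH" and "\<And>x. x \<in> I \<Longrightarrow> F x \<in> BH"
    and "weakly_measurable_on I V" and "weakly_measurable_on I F"
    and "(\<lambda>x. norm (V x)) \<in> L1loc I" and "(\<lambda>x. norm (F x)) \<in> L1loc I"
  shows "\<exists>E \<in> null_sets lebesgue. \<exists>Y Y' Y'' :: complex \<Rightarrow> real \<Rightarrow> 'a \<Rightarrow>\<^sub>L 'a.
    (\<forall>z. is_ivp_solution I (\<lambda>x. V x - cscale z) F x\<^sub>0 Y\<^sub>0 Y\<^sub>1 (Y z) \<and>
         (\<forall>U. is_ivp_solution I (\<lambda>x. V x - cscale z) F x\<^sub>0 Y\<^sub>0 Y\<^sub>1 U \<longrightarrow> (\<forall>x\<in>I. U x = Y z x))) \<and>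
    (\<forall>z. \<forall>x\<in>I - E. - Y'' z x + ((V x - cscale z) o\<^sub>L Y z x) = F x) \<and>
    (\<forall>z. (\<forall>x\<in>I. (Y z has_vector_derivative Y' z x) (at x)) \<and> continuous_on I (Y' z)) \<and>
    (\<forall>z. \<forall>x\<in>I - E. has_strong_derivative (Y' z) (Y'' z x) x) \<and>
    (\<forall>x\<in>I. entire_BH (\<lambda>z. Y z x) \<and> entire_BH (\<lambda>z. Y' z x))"
proof -
  have "is_interval I"
    unfolding is_interval_1
  proof (intro ballI allI impI)
    fix p q r assume "p \<in> I" "q \<in> I" "p \<le> r \<and> r \<le> q"
    then show "r \<in> I"
      using less_le_trans[of a "ereal p" "ereal r"] le_less_trans[of "ereal r" "ereal q" b]
      by (simp add: assms(1) einterval_iff)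
  qed
  moreover have "open I" by (simp add: assms(1))
  ultimately have I: "is_interval I" "open I" .
  interpret V: L1loc_operator I x\<^sub>0 V
    by unfold_locales (fact I assms)+
  interpret operator_ivp I x\<^sub>0 V ..
  have F: "L1loc_operator I x\<^sub>0 F"
    by unfold_locales (fact I assms)+
  have "\<forall>z. \<exists>Y Y'. ivp_pair z F Y\<^sub>0 Y\<^sub>1 Y Y' \<and> (\<forall>x\<in>I. Y x \<in> BH \<and> Y' x \<in> BH)"
    by (intro allI ivp_pair_exists F assms(3,4))
  from choice[OF this] obtain Y
    where "\<forall>z. \<exists>Y'. ivp_pair z F Y\<^sub>0 Y\<^sub>1 (Y z) Y' \<and> (\<forall>x\<in>I. Y z x \<in> BH \<and> Y' x \<in> BH)" ..
  from choice[OF this] obtain Y'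
    where "\<forall>z. ivp_pair z F Y\<^sub>0 Y\<^sub>1 (Y z) (Y' z) \<and> (\<forall>x\<in>I. Y z x \<in> BH \<and> Y' z x \<in> BH)" ..
  then have pair: "ivp_pair z F Y\<^sub>0 Y\<^sub>1 (Y z) (Y' z)" and BH: "x \<in> I \<Longrightarrow> Y z x \<in> BH" for z x
    by simp_all
  from pair_has_strong_derivative_ae[OF F, of Y\<^sub>0 Y\<^sub>1] obtain E where E: "negligible E"
    and "\<forall>z Y Y'. ivp_pair z F Y\<^sub>0 Y\<^sub>1 Y Y' \<longrightarrow>
      (\<forall>x\<in>I - E. has_strong_derivative Y' (((V x - cscale z) o\<^sub>L Y x) - F x) x)"
    by (elim exE conjE)
  then have deriv: "has_strong_derivative (Y' z) (((V x - cscale z) o\<^sub>L Y z x) - F x) x"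
    if "x \<in> I - E" for z x
    using pair that by simp
  show ?thesis
  proof (rule bexI[of _ E], rule exI[of _ Y], rule exI[of _ Y'],
      rule exI[of _ "\<lambda>z x. ((V x - cscale z) o\<^sub>L Y z x) - F x"], intro conjI allI ballI impI)
    show "E \<in> null_sets lebesgue" using E by (simp add: negligible_iff_null_sets)
    fix z
    show "is_ivp_solution I (\<lambda>x. V x - cscale z) F x\<^sub>0 Y\<^sub>0 Y\<^sub>1 (Y z)"
      by (rule pair_is_ivp_solution[OF F pair BH])
    show "continuous_on I (Y' z)" by (rule pair_derivative_norm_continuous[OF F pair])
    fix x
    show "U x = Y z x" if "is_ivp_solution I (\<lambda>x. V x - cscale z) F x\<^sub>0 Y\<^sub>0 Y\<^sub>1 U" "x \<in> I" for U
      using ivp_solution_unique[OF F pair that] .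
    show "(Y z has_vector_derivative Y' z x) (at x)" if "x \<in> I"
      by (rule pair_has_vector_derivative[OF F pair that])
    show "- (((V x - cscale z) o\<^sub>L Y z x) - F x) + ((V x - cscale z) o\<^sub>L Y z x) = F x" by simp
    show "has_strong_derivative (Y' z) (((V x - cscale z) o\<^sub>L Y z x) - F x) x" if "x \<in> I - E"
      using that by (rule deriv)
  next
    fix x assume "x \<in> I"
    show "entire_BH (\<lambda>z. Y z x)" "entire_BH (\<lambda>z. Y' z x)"
      by (rule ivp_pair_entire[OF F pair BH \<open>x \<in> I\<close>]; assumption)+
  qed
qed

end
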